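(* Let $\beta=(\beta_1,\ldots,\beta_{2\ell})$ be a composition with an even number of parts, and let $\overline{F}(\beta)$ be the corresponding circular fence. The map $\overline{\Phi}$ defined by steps (PHC1)–(PHC3) below is a cardinality-preserving bijection from the set of lower order ideals of $\overline{F}(\beta)$ to the set of upper order ideals (filters) of $\overline{F}(\beta)$.
   Context: With $n=\sum\beta_i$, the fence $F(\beta)$ (obtained from chains $S_1,\dots,S_{2\ell}$, $\#S_i=\beta_i+1$, by identifying maximal elements of $S_i,S_{i+1}$ for $i$ odd and minimal elements for $i$ even) has elements $x_1,\dots,x_{n+1}$ left to right; $\overline{F}(\beta)$ is obtained by identifying $x_1$ and $x_{n+1}$. Its ascending segments are $A_i=S_{2i-1}$ and descending segments $D_i=S_{2i}$, $1\le i\le\ell$. Let $\tilde A_i$ be the set of elements of $A_i$ not lying on another segment, $\alpha_i=\beta_{2i-1}=1+\#\tilde A_i$, $\delta_i=\beta_{2i}$ (so $\#D_i=\delta_i+1$); the $\tilde A_i$ and $D_i$ partition $\overline{F}(\beta)$. A lower order ideal $I$ is encoded by $a_i=\#(I\cap\tilde A_i)$, $d_i=\#(I\cap D_i)$, and a filter $U$ by $b_i=\#(U\cap\tilde A_i)$, $e_i=\#(U\cap D_i)$; these determine $I$, $U$. All indices are taken modulo $\ell$. Linear map $\phi$ on finite sequences of nonnegative integers: a block is a maximal run of consecutive positive entries, its trailing ones $T$ is its maximal (possibly empty) final segment of ones, $B'$ is $B$ with $T$ removed; (P1) for each block with nonempty $T$, exchange $T$ with the $0$ immediately following it; (P2)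 for each block with $\#B'\ge2$, decrease the last entry of $B'$ by $1$ and increase its first entry by $1$. Circular map $\overline{\phi}$: if all entries of $d$ are positive it returns $d$; otherwise it applies (P1),(P2) to $d$ regarded as a circular sequence ($d_\ell$ followed by $d_1$, blocks being maximal cyclic runs of positive entries). Given $I$ encoded by $(a,d)$: (PHC1) for every $i\in[\ell]$ with $d_i=1$ and $a_{i+1}<\alpha_{i+1}-1$, set $d_i:=0$, $a_{i+1}:=a_{i+1}+1$. (PHC2) If some $i\in[\ell]$ has $a_i<\alpha_i-1$, cut the circular sequence $d$ between $d_{i-1}$ and $d_i$ for each such $i$, producing linear factors (runs of cyclically consecutive entries), apply $\phi$ to each factor and put the results back in the same positions; if no such $i$ exists, apply $\overline{\phi}$ to $d$. Call the result $e$ and set $b:=a$. (PHC3) For every $i\in[\ell]$ with $e_i=0$ and $b_i>0$, set $e_i:=1$, $b_i:=b_i-1$. Then $\overline{\Phi}(I)$ is the filter encoded by $(b,e)$. *)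

theory Defs
  imports Main
begin

text \<open>
  All indices are shifted to start at 0: the elements of the fence are the positions
  \<open>0, \<dots>, n\<close> from left to right, the segments are numbered \<open>0, \<dots>, 2 * \<ell> - 1\<close> (so the
  even-numbered ones ascend and the odd-numbered ones descend), and
  \<open>A\<close>, \<open>D\<close>, \<open>\<alpha>\<close>, \<open>\<delta>\<close>, \<open>a\<close>, \<open>d\<close>, \<open>b\<close>, \<open>e\<close> have indices \<open>0, \<dots>, \<ell> - 1\<close>, read modulo \<open>\<ell>\<close>.
\<close>

definition composition :: "nat list \<Rightarrow> bool" where
  "composition \<beta> \<longleftrightarrow> (\<forall>x \<in> set \<beta>. 0 < x)"

abbreviation half :: "nat list \<Rightarrow> nat" where
  "half \<beta> \<equiv> length \<beta> div 2"


subsection \<open>The circular fence\<close>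

definition segment :: "nat list \<Rightarrow> nat \<Rightarrow> nat set" where
  "segment \<beta> k = {sum_list (take k \<beta>) .. sum_list (take (Suc k) \<beta>)}"

definition chain_rel :: "nat list \<Rightarrow> (nat \<times> nat) set" where
  "chain_rel \<beta> = {(x, y). \<exists>k < length \<beta>. x \<in> segment \<beta> k \<and> y \<in> segment \<beta> k \<and>
     (if even k then x \<le> y else y \<le> x)}"

text \<open>On \<open>{0..n}\<close> reduction modulo \<open>n\<close> identifies exactly the two end points \<open>0\<close> and \<open>n\<close>.\<close>

definition glue :: "nat list \<Rightarrow> nat \<Rightarrow> nat" where
  "glue \<beta> x = x mod sum_list \<beta>"

definition circ_fence :: "nat list \<Rightarrow> nat set" where
  "circ_fence \<beta> = glue \<beta> ` {0..sum_list \<beta>}"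

definition circ_fence_le :: "nat list \<Rightarrow> nat \<Rightarrow> nat \<Rightarrow> bool" where
  "circ_fence_le \<beta> x y \<longleftrightarrow> (x, y) \<in> (map_prod (glue \<beta>) (glue \<beta>) ` chain_rel \<beta>)\<^sup>+"

definition circ_segment :: "nat list \<Rightarrow> nat \<Rightarrow> nat set" where
  "circ_segment \<beta> k = glue \<beta> ` segment \<beta> k"

definition A_tilde :: "nat list \<Rightarrow> nat \<Rightarrow> nat set" where
  "A_tilde \<beta> i = circ_segment \<beta> (2 * i) -
     (\<Union>k \<in> {..<length \<beta>} - {2 * i}. circ_segment \<beta> k)"

definition D_seg :: "nat list \<Rightarrow> nat \<Rightarrow> nat set" where
  "D_seg \<beta> i = circ_segment \<beta> (2 * i + 1)"

definition alpha :: "nat list \<Rightarrow> nat \<Rightarrow> nat" where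
  "alpha \<beta> i = \<beta> ! (2 * i)"

definition lower_ideals :: "nat list \<Rightarrow> nat set set" where
  "lower_ideals \<beta> = {I. I \<subseteq> circ_fence \<beta> \<and>
     (\<forall>y \<in> I. \<forall>x \<in> circ_fence \<beta>. circ_fence_le \<beta> x y \<longrightarrow> x \<in> I)}"

definition upper_ideals :: "nat list \<Rightarrow> nat set set" where
  "upper_ideals \<beta> = {U. U \<subseteq> circ_fence \<beta> \<and>
     (\<forall>x \<in> U. \<forall>y \<in> circ_fence \<beta>. circ_fence_le \<beta> x y \<longrightarrow> y \<in> U)}"


subsection \<open>The linear and the circular map on sequences\<close>

definition shift_unit :: "nat list \<Rightarrow> nat list" where
  "shift_unit B = (if 2 \<le> length B then (hd B + 1) # butlast (tl B) @ [last B - 1] else B)"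

definition trailing_ones :: "nat list \<Rightarrow> nat list" where
  "trailing_ones B = rev (takeWhile (\<lambda>x. x = 1) (rev B))"

definition without_trailing_ones :: "nat list \<Rightarrow> nat list" where
  "without_trailing_ones B = rev (dropWhile (\<lambda>x. x = 1) (rev B))"

text \<open>
  Both steps refer to the blocks of the original sequence; a block that ends the sequence
  has no \<open>0\<close> to be exchanged with, and its trailing ones stay in place.
\<close>

function phi :: "nat list \<Rightarrow> nat list" where
  "phi [] = []"
| "phi (x # xs) =
    (if x = 0 then 0 # phi xs
     else let B = takeWhile (\<lambda>y. 0 < y) (x # xs)
          in shift_unit (without_trailing_ones B) @
             (case dropWhile (\<lambda>y. 0 < y) (x # xs) of
                [] \<Rightarrow> trailing_ones B
              | z # R \<Rightarrow> z # trailing_ones B @ phi R))"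
  by pat_completeness auto
termination
proof (relation "measure length")
  fix x z :: nat and xs R B :: "nat list"
  assume "dropWhile (\<lambda>y. 0 < y) (x # xs) = z # R"
  then have "length (z # R) \<le> length (x # xs)"
    by (metis length_dropWhile_le)
  then show "(R, x # xs) \<in> measure length"
    by simp
qed auto

text \<open>
  If the circular sequence is read off starting just after one of its zeros, then the
  cyclic blocks become linear blocks, each followed by its \<open>0\<close>. By lemma
  \<open>rotate_phi_circ\<close> below, the choice of zero is irrelevant.
\<close>

definition phi_circ :: "nat list \<Rightarrow> nat list" where
  "phi_circ d =
    (if \<forall>x \<in> set d. 0 < x then d
     else let k = Suc (LEAST j. j < length d \<and> d ! j = 0)
          in rotate (length d - k) (phi (rotate k d)))"

lemma length_shift_unit [simp]: "length (shift_unit B) = length B"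
  by (cases B) (auto simp: shift_unit_def)

lemma length_without_trailing:
  "length (without_trailing_ones B) + length (trailing_ones B) = length B"
  unfolding without_trailing_ones_def trailing_ones_def
  by (metis add.commute length_append length_rev takeWhile_dropWhile_id)

lemma length_phi [simp]: "length (phi d) = length d"
proof (induction d rule: phi.induct)
  case (2 x xs)
  show ?case
  proof (cases "x = 0")
    case False
    let ?B = "takeWhile (\<lambda>y. 0 < y) (x # xs)" and ?R = "dropWhile (\<lambda>y. 0 < y) (x # xs)"
    have "length ?B + length ?R = length (x # xs)"
      by (metis length_append takeWhile_dropWhile_id)
    moreover have "length (phi R) = length R" if "?R = z # R" for z R
      using "2.IH"(2)[OF False refl that] .
    ultimately show ?thesis
      using False length_without_trailing[of ?B]
      by (cases ?R) (simp_all only: phi.simps Let_def if_False list.case length_append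
        length_shift_unit list.size)
  qed (use "2.IH"(1) in simp)
qed simp

lemma phi_append_0: "phi (xs @ 0 # ys) = phi (xs @ [0]) @ phi ys"
proof (induction xs rule: phi.induct)
  case (2 x xs)
  show ?case
  proof (cases "x = 0")
    case False
    show ?thesis
    proof (cases "dropWhile (\<lambda>y. 0 < y) (x # xs)")
      case Nil
      then have "\<forall>y \<in> set (x # xs). 0 < y"
        by (simp only: dropWhile_eq_Nil_conv)
      then show ?thesis
        by (simp add: Let_def takeWhile_append dropWhile_append)
    next
      case (Cons z R)
      then have "\<not> (\<forall>y \<in> set xs. 0 < y)"
        using False by (metis dropWhile_eq_Nil_conv gr0I list.distinct(1) set_ConsD)
      then have nz: "0 \<in> set xs"
        by auto
      show ?thesis
        using False Cons nz "2.IH"(2)[OF False refl Cons]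
        by (auto simp: Let_def takeWhile_append dropWhile_append)
    qed
  qed (use "2.IH"(1) in simp)
qed simp

lemma rotate_phi_circ:
  assumes "k < length d" "d ! k = 0"
  shows "rotate (Suc k) (phi_circ d) = phi (rotate (Suc k) d)"
proof -
  define m where "m = (LEAST j. j < length d \<and> d ! j = 0)"
  have m: "m < length d" "d ! m = 0" and mk: "m \<le> k"
    using LeastI[of "\<lambda>j. j < length d \<and> d ! j = 0" k] Least_le[of "\<lambda>j. j < length d \<and> d ! j = 0" k]
      assms unfolding m_def by auto
  have c: "phi_circ d = rotate (length d - Suc m) (phi (rotate (Suc m) d))"
    using m nth_mem[OF m(1)] unfolding phi_circ_def m_def[symmetric] Let_def by force
  define P where "P = take m d"
  have d: "d = P @ 0 # drop (Suc m) d" and lP: "length P = m"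
    using m id_take_nth_drop[OF m(1)] by (auto simp: P_def)
  have rm: "rotate (Suc m) d = drop (Suc m) d @ P @ [0]"
    using m take_Suc_conv_app_nth[OF m(1)] by (simp add: rotate_drop_take P_def del: rotate_Suc)
       (cases "Suc m = length d"; simp)
  show ?thesis
  proof (cases "k = m")
    case True
    have "rotate (Suc m) (phi_circ d) = rotate (length d) (phi (rotate (Suc m) d))"
      unfolding c rotate_rotate using le_add_diff_inverse[OF Suc_leI[OF m(1)]] by (rule arg_cong)
    also have "\<dots> = phi (rotate (Suc m) d)"
      by (rule rotate_id) simp
    finally show ?thesis using True by simp
  next
    case False
    with mk have mk: "m < k" by simp
    define Q where "Q = take (k - Suc m) (drop (Suc m) d)"
    define R where "R = drop (Suc k) d"
    have dr: "drop (Suc m) d = Q @ 0 # R"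
      using id_take_nth_drop[of "k - Suc m" "drop (Suc m) d"] mk assms
      by (simp add: Q_def R_def)
    have dd: "d = (P @ 0 # Q @ [0]) @ R"
      by (rule trans[OF d]) (simp add: dr)
    have ld: "length (P @ 0 # Q @ [0]) = Suc k"
      using mk assms(1) by (simp add: lP Q_def)
    have rk: "rotate (Suc k) d = R @ P @ 0 # Q @ [0]"
      by (subst dd, subst ld[symmetric], subst rotate_append) simp
    have e1: "phi (rotate (Suc k) d) = phi (R @ P @ [0]) @ phi (Q @ [0])"
      using phi_append_0[of "R @ P" "Q @ [0]"] unfolding rk by simp
    have e2: "phi (rotate (Suc m) d) = phi (Q @ [0]) @ phi (R @ P @ [0])"
      using phi_append_0[of Q "R @ P @ [0]"] unfolding rm dr by simp
    have "rotate (Suc k) (phi_circ d) = rotate (length d + (k - m)) (phi (rotate (Suc m) d))"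
      unfolding c rotate_rotate
      by (rule arg_cong[where f = "\<lambda>i. rotate i (phi (rotate (Suc m) d))"]) (use m(1) mk in simp)
    also have "\<dots> = rotate (k - m) (phi (rotate (Suc m) d))"
      by (subst add.commute, subst rotate_rotate[symmetric], subst rotate_id[of "length d"]) simp_all
    also have "k - m = length (phi (Q @ [0]))"
      using mk assms(1) by (simp add: Q_def)
    finally show ?thesis
      unfolding e1 e2 rotate_append .
  qed
qed


subsection \<open>The three steps\<close>

text \<open>A code is a pair \<open>(a, d)\<close>, of which only the values at indices below \<open>\<ell>\<close> matter.\<close>

type_synonym ideal_code = "(nat \<Rightarrow> nat) \<times> (nat \<Rightarrow> nat)"

definition encode :: "nat list \<Rightarrow> nat set \<Rightarrow> ideal_code" where
  "encode \<beta> X = (\<lambda>i. card (X \<inter> A_tilde \<beta> i), \<lambda>i. card (X \<inter> D_seg \<beta> i))"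

definition encoded_by :: "nat list \<Rightarrow> nat set \<Rightarrow> ideal_code \<Rightarrow> bool" where
  "encoded_by \<beta> X = (\<lambda>(a, d). \<forall>i < half \<beta>.
     card (X \<inter> A_tilde \<beta> i) = a i \<and> card (X \<inter> D_seg \<beta> i) = d i)"

definition cyc_suc :: "nat \<Rightarrow> nat \<Rightarrow> nat" where
  "cyc_suc l i = (i + 1) mod l"

definition cyc_pred :: "nat \<Rightarrow> nat \<Rightarrow> nat" where
  "cyc_pred l i = (i + l - 1) mod l"

definition PHC1 :: "nat list \<Rightarrow> ideal_code \<Rightarrow> ideal_code" where
  "PHC1 \<beta> = (\<lambda>(a, d).
     let l = half \<beta>;
         moves = (\<lambda>i. d i = 1 \<and> a (cyc_suc l i) < alpha \<beta> (cyc_suc l i) - 1)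
     in (\<lambda>i. if moves (cyc_pred l i) then a i + 1 else a i,
         \<lambda>i. if moves i then 0 else d i))"

text \<open>
  \<open>C\<close> is the set of those \<open>i\<close> for which the circular sequence \<open>d\<close> of length \<open>l\<close> is cut
  just before \<open>d i\<close>. Index \<open>i\<close> lies at distance \<open>cut_dist l C i\<close> after the start of its factor.
\<close>

definition factor_at :: "nat \<Rightarrow> nat set \<Rightarrow> (nat \<Rightarrow> nat) \<Rightarrow> nat \<Rightarrow> nat list" where
  "factor_at l C d s =
     map (\<lambda>j. d ((s + j) mod l)) [0..<(LEAST k. 0 < k \<and> (s + k) mod l \<in> C)]"

definition cut_dist :: "nat \<Rightarrow> nat set \<Rightarrow> nat \<Rightarrow> nat" where
  "cut_dist l C i = (LEAST t. (i + l - t) mod l \<in> C)"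

definition phi_factors :: "nat \<Rightarrow> nat set \<Rightarrow> (nat \<Rightarrow> nat) \<Rightarrow> nat \<Rightarrow> nat" where
  "phi_factors l C d i =
     phi (factor_at l C d ((i + l - cut_dist l C i) mod l)) ! cut_dist l C i"

definition PHC2 :: "nat list \<Rightarrow> ideal_code \<Rightarrow> ideal_code" where
  "PHC2 \<beta> = (\<lambda>(a, d).
     let l = half \<beta>;
         C = {i. i < l \<and> a i < alpha \<beta> i - 1}
     in (a, if C \<noteq> {} then phi_factors l C d
            else (\<lambda>i. phi_circ (map d [0..<l]) ! i)))"

definition PHC3 :: "ideal_code \<Rightarrow> ideal_code" where
  "PHC3 = (\<lambda>(b, e).
     (\<lambda>i. if e i = 0 \<and> 0 < b i then b i - 1 else b i,
      \<lambda>i. if e i = 0 \<and> 0 < b i then 1 else e i))"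

definition PHC :: "nat list \<Rightarrow> ideal_code \<Rightarrow> ideal_code" where
  "PHC \<beta> c = PHC3 (PHC2 \<beta> (PHC1 \<beta> c))"

definition Phi_circ :: "nat list \<Rightarrow> nat set \<Rightarrow> nat set" where
  "Phi_circ \<beta> I = (THE U. U \<in> upper_ideals \<beta> \<and> encoded_by \<beta> U (PHC \<beta> (encode \<beta> I)))"

end

theory Submission
  imports Defs
begin

text \<open>
  On sequences not ending in a one, reversal conjugates \<open>phi\<close> to its inverse: every block is
  \<open>B' T\<close>, where \<open>B'\<close> does not end in a one, and \<open>phi\<close> puts \<open>T\<close> in front of the next block,
  which then is \<open>T\<close> followed by a sequence that does not start with a one. The same holds for
  \<open>phi_circ\<close> on all sequences.
  For a pair of an entry of \<open>d\<close> and the next entry of \<open>a\<close>, \<open>PHC1\<close> replaces the condition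
  "\<open>0 < a (i + 1)\<close> implies \<open>0 < d i\<close>" by "\<open>d i = 1\<close> implies \<open>a (i + 1) = \<alpha> (i + 1) - 1\<close>", that is,
  by the condition that no factor ends in a one; dually for \<open>PHC3\<close>. So all three steps
  are injective and preserve the sum. Taking complements shows that there are as many ideals
  as filters, so injectivity suffices.
\<close>

subsection \<open>Linear and circular sequences\<close>

text \<open>The delicate point is that codes of ideals are sent to codes of filters. Before (PHC2),
  \<open>d j\<close> is at most \<open>delta \<beta> j\<close>, but may be one larger if
  \<open>a j\<close> is maximal and the entry before \<open>d j\<close> is positive; afterwards the
  next index has to grant this excess. \<open>phi\<close> turns one rule into the other: in a block
  \<open>B'\<close> of length at least two, the first entry has no allowance and the last has one,
  and the unit moves from the last to the first. As \<open>B'\<close> does not end in a one, its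
  last entry is at least 2 and stays positive, so it can grant the allowance to its neighbour. The
  exchanged ones and zeros fit anywhere, because every \<open>delta \<beta> i\<close> is positive.
  An entry \<open>d j\<close> whose \<open>a j\<close> is not maximal never has the allowance, and
  (PHC2) cuts exactly before these entries, so the factors can be treated separately.\<close>

abbreviation no_final_one :: "nat list \<Rightarrow> bool" where
  "no_final_one xs \<equiv> xs = [] \<or> last xs \<noteq> 1"

lemma phi_pos:
  assumes "\<forall>x \<in> set B. 0 < x"
  shows "phi B = shift_unit (without_trailing_ones B) @ trailing_ones B"
proof (cases B)
  case (Cons x xs)
  have t: "takeWhile (\<lambda>y. 0 < y) B = B" "dropWhile (\<lambda>y. 0 < y) B = []"
    using assms by (simp_all add: takeWhile_eq_all_conv)
  have "x \<noteq> 0" using assms Cons by simp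
  then show ?thesis
    using t unfolding Cons phi.simps Let_def by (simp only: if_False list.case)
qed (simp add: shift_unit_def without_trailing_ones_def trailing_ones_def)

lemma phi_pos_0:
  assumes "\<forall>x \<in> set B. 0 < x"
  shows "phi (B @ [0]) = shift_unit (without_trailing_ones B) @ 0 # trailing_ones B"
proof (cases B)
  case (Cons x xs)
  have t: "takeWhile (\<lambda>y. 0 < y) (B @ [0]) = B" "dropWhile (\<lambda>y. 0 < y) (B @ [0]) = [0]"
    using assms by (simp_all add: takeWhile_append dropWhile_append)
  have "x \<noteq> 0" using assms Cons by simp
  then show ?thesis
    using t unfolding Cons append_Cons phi.simps Let_def
    by (simp only: if_False list.case phi.simps append_Nil2)
qed (simp add: shift_unit_def without_trailing_ones_def trailing_ones_def)

lemma trailing_split: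
  assumes "\<forall>x \<in> set T. x = 1" "no_final_one Z"
  shows "trailing_ones (Z @ T) = T" "without_trailing_ones (Z @ T) = Z"
proof -
  have *: "takeWhile (\<lambda>x. x = 1) (rev Z) = [] \<and> dropWhile (\<lambda>x. x = 1) (rev Z) = rev Z"
    using assms(2) by (cases Z rule: rev_cases) auto
  show "trailing_ones (Z @ T) = T" "without_trailing_ones (Z @ T) = Z"
    unfolding trailing_ones_def without_trailing_ones_def
    using assms(1) * by (auto simp: takeWhile_append dropWhile_append)
qed

lemma trailing_ones_decomp:
  obtains Z T where "W = Z @ T" "\<forall>x \<in> set T. x = (1::nat)" "no_final_one Z"
proof
  show "W = without_trailing_ones W @ trailing_ones W"
    unfolding trailing_ones_def without_trailing_ones_def
    by (metis rev_append rev_rev_ident takeWhile_dropWhile_id)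
  show "\<forall>x \<in> set (trailing_ones W). x = 1"
    unfolding trailing_ones_def using set_takeWhileD by fastforce
  show "no_final_one (without_trailing_ones W)"
    using hd_dropWhile[of "\<lambda>x. x = 1" "rev W"]
    unfolding without_trailing_ones_def by (cases "dropWhile (\<lambda>x. x = 1) (rev W) = []") (simp_all add: last_rev)
qed

lemma phi_block:
  assumes "\<forall>x \<in> set Z. 0 < x" "no_final_one Z"
  shows "phi Z = shift_unit Z"
  using phi_pos[OF assms(1)] trailing_split[of "[]" Z] assms(2) by simp

lemma phi_block_0:
  assumes "\<forall>x \<in> set Z. 0 < x" "no_final_one Z" "\<forall>x \<in> set T. x = 1"
  shows "phi (Z @ T @ 0 # R) = shift_unit Z @ 0 # T @ phi R"
proof -
  have "\<forall>x \<in> set (Z @ T). 0 < x" using assms by auto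
  from phi_pos_0[OF this] show ?thesis
    using phi_append_0[of "Z @ T" R] trailing_split[of T Z] assms by simp
qed

text \<open>The block decomposition, read from the left. Trailing ones of a final block would have
  no \<open>0\<close> to cross; as the sequence does not end in a one, there are none, so the base
  case is a bare \<open>Z\<close>. In the step \<open>Z\<close>, \<open>T\<close> and
  \<open>R\<close> may be empty.\<close>

lemma list_block_induct [consumes 1, case_names block step]:
  assumes "no_final_one d"
    and block: "\<And>Z. \<forall>x \<in> set Z. 0 < x \<Longrightarrow> no_final_one Z \<Longrightarrow> P Z"
    and step: "\<And>Z T R. \<forall>x \<in> set Z. 0 < x \<Longrightarrow> no_final_one Z \<Longrightarrow>
      \<forall>x \<in> set T. x = 1 \<Longrightarrow> no_final_one R \<Longrightarrow> P R \<Longrightarrow> P (Z @ T @ 0 # R)"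
  shows "P d"
  using assms(1)
proof (induction d rule: length_induct)
  case (1 d)
  show ?case
  proof (cases "0 \<in> set d")
    case False
    then show ?thesis using block 1(2) by (metis gr0I)
  next
    case True
    then obtain B R where d: "d = B @ 0 # R" and B: "0 \<notin> set B"
      by (meson split_list_first)
    obtain Z T where W: "B = Z @ T" "\<forall>x \<in> set T. x = (1::nat)" "no_final_one Z"
      by (rule trailing_ones_decomp[of B]) blast
    have R: "no_final_one R" using 1(2) d by (cases "R = []") simp_all
    have "P R" using 1(1)[rule_format, of R] R d by simp
    moreover have "\<forall>x \<in> set Z. 0 < x" using B W(1) by (auto intro: gr0I)
    ultimately show ?thesis
      using step[of Z T R] W R d by simp
  qed
qed

text \<open>If \<open>V\<close> ends in a positive entry, \<open>T\<close> lengthens its last block;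
  but as \<open>V\<close> does not end in a one, the trailing ones of the longer block are exactly
  \<open>T\<close>. So only \<open>T\<close> crosses the new \<open>0\<close>, and \<open>V\<close>
  is treated as if it stood alone.\<close>

lemma phi_snoc_ones_0:
  assumes "no_final_one V" "\<forall>x \<in> set T. x = 1"
  shows "phi (V @ T @ [0]) = phi V @ 0 # T"
  using assms(1)
proof (induction V rule: list_block_induct)
  case (block Z)
  then show ?case using phi_block[of Z] phi_block_0[of Z T "[]"] assms(2) by simp
next
  case (step Z S R)
  then show ?case using phi_block_0[of Z S "R @ T @ [0]"] phi_block_0[of Z S R] by simp
qed

lemma shift_unit_long: "shift_unit (x # M @ [y]) = (x + 1) # M @ [y - 1]"
  by (simp add: shift_unit_def butlast_append)

text \<open>\<open>shift_unit\<close> changes only the third shape, where \<open>y - 1\<close> is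
  still positive.\<close>

lemma block_cases:
  assumes "\<forall>x \<in> set Z. 0 < x" "no_final_one Z"
  obtains "Z = []" | x where "Z = [x]" "2 \<le> x"
    | x M y where "Z = x # M @ [y]" "0 < x" "\<forall>z \<in> set M. 0 < z" "2 \<le> y"
proof (cases Z)
  case (Cons x xs)
  then show ?thesis
  proof (cases xs rule: rev_cases)
    case Nil
    then show ?thesis using that(2) assms Cons by simp
  next
    case (snoc M y)
    then show ?thesis using that(3)[of x M y] assms Cons by simp
  qed
qed (use that in blast)

lemma sum_list_phi:
  assumes "no_final_one d"
  shows "sum_list (phi d) = sum_list d"
proof -
  have s: "sum_list (shift_unit Z) = sum_list Z"
    if "\<forall>x \<in> set Z. 0 < x" "no_final_one Z" for Z
    using that
  proof (cases rule: block_cases)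
    case (3 x M y)
    then show ?thesis by (simp add: shift_unit_long)
  qed (auto simp: shift_unit_def)
  show ?thesis using assms
  proof (induction rule: list_block_induct)
    case (block Z)
    then show ?case using phi_block[of Z] s[of Z] by simp
  next
    case (step Z T R)
    then show ?case using phi_block_0[of Z T R] s[of Z] by simp
  qed
qed

text \<open>A shifted block starts with \<open>x + 1\<close> or is a single entry at least 2, so it
  does not start with a one. Its reversal is therefore again a block without trailing ones, and
  shifting that one moves the unit back.\<close>

lemma shift_unit_block:
  assumes "\<forall>x \<in> set Z. 0 < x" "no_final_one Z"
  shows "\<forall>x \<in> set (shift_unit Z). 0 < x" "no_final_one (rev (shift_unit Z))"
    "shift_unit (rev (shift_unit Z)) = rev Z"
proof -
  show "\<forall>x \<in> set (shift_unit Z). 0 < x"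
    using assms by (cases rule: block_cases) (auto simp: shift_unit_long, auto simp: shift_unit_def)
  show "no_final_one (rev (shift_unit Z))"
    using assms by (cases rule: block_cases) (auto simp: shift_unit_long, auto simp: shift_unit_def)
  show "shift_unit (rev (shift_unit Z)) = rev Z"
    using assms
  proof (cases rule: block_cases)
    case (3 x M y)
    have "rev ((x + 1) # M @ [y - 1]) = (y - 1) # rev M @ [x + 1]" by simp
    then show ?thesis using 3 by (simp only: shift_unit_long) simp
  qed (auto simp: shift_unit_def)
qed

text \<open>Makes \<open>phi\<close> invertible again on the reversed image: a nonempty image starts
  with a shifted block, whose first entry is at least 2, or with a \<open>0\<close>.\<close>

lemma no_final_one_rev_phi:
  assumes "no_final_one d"
  shows "no_final_one (rev (phi d))"
  using assms
proof (induction rule: list_block_induct)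
  case (block Z)
  then show ?case using phi_block[of Z] shift_unit_block(2)[of Z] by simp
next
  case (step Z T R)
  then show ?case using phi_block_0[of Z T R] shift_unit_block(2)[of Z]
    by (cases "shift_unit Z = []") auto
qed

lemma rev_phi_inverse:
  assumes "no_final_one d"
  shows "phi (rev (phi d)) = rev d"
  using assms
proof (induction rule: list_block_induct)
  case (block Z)
  then show ?case
    using phi_block[of Z] phi_block[of "rev (shift_unit Z)"] shift_unit_block[of Z]
    by (simp add: last_rev)
next
  case (step Z T R)
  have rT: "rev T = T" using step(3)
    by (metis replicate_eqI rev_replicate)
  have Z: "phi (rev (shift_unit Z)) = rev Z"
    using step phi_block[of "rev (shift_unit Z)"] shift_unit_block[of Z] by (simp add: last_rev)
  have "rev (phi (Z @ T @ 0 # R)) = (rev (phi R) @ T) @ 0 # rev (shift_unit Z)"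
    using step phi_block_0[of Z T R] rT by simp
  also have "phi \<dots> = phi (rev (phi R) @ T @ [0]) @ rev Z"
    using phi_append_0[of "rev (phi R) @ T" "rev (shift_unit Z)"] Z by simp
  \<comment> \<open>\<open>rev (phi R)\<close> does not end in a one, so exactly \<open>T\<close>
    moves back across the \<open>0\<close>.\<close>
  also have "phi (rev (phi R) @ T @ [0]) = phi (rev (phi R)) @ 0 # T"
    by (rule phi_snoc_ones_0) (use step no_final_one_rev_phi[of R] in \<open>auto simp: last_rev\<close>)
  finally show ?case using step rT by simp
qed


text \<open>
  The bounds on an ideal: an entry of \<open>xs\<close> may exceed the corresponding bound in \<open>us\<close>, by one,
  only if the preceding entry is positive. The flag \<open>p\<close> stands for the entry before \<open>xs\<close>.
  For filters the following entry takes this role, whence the reversed lists below.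
\<close>

fun fits :: "bool \<Rightarrow> nat list \<Rightarrow> nat list \<Rightarrow> bool" where
  "fits p [] [] \<longleftrightarrow> True"
| "fits p (x # xs) (u # us) \<longleftrightarrow> x \<le> u + of_bool p \<and> fits (0 < x) xs us"
| "fits p _ _ \<longleftrightarrow> False"

lemma fits_append:
  assumes "length xs = length us"
  shows "fits p (xs @ ys) (us @ vs) \<longleftrightarrow>
    fits p xs us \<and> fits (if xs = [] then p else 0 < last xs) ys vs"
  using assms by (induction xs us arbitrary: p rule: list_induct2) auto

lemma fits_length: "fits p xs us \<Longrightarrow> length xs = length us"
  by (induction p xs us rule: fits.induct) auto

lemma fits_iff_nth:
  assumes "length xs = length us"
  shows "fits p xs us \<longleftrightarrow>
    (\<forall>i < length xs. xs ! i \<le> us ! i + of_bool (if i = 0 then p else 0 < xs ! (i - 1)))"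
  using assms
proof (induction xs us arbitrary: p rule: list_induct2)
  case (Cons x xs u us)
  have "(\<forall>i < length (x # xs). (x # xs) ! i \<le> (u # us) ! i +
      of_bool (if i = 0 then p else 0 < (x # xs) ! (i - 1))) \<longleftrightarrow>
    x \<le> u + of_bool p \<and> (\<forall>i < length xs. xs ! i \<le> us ! i +
      of_bool (if i = 0 then 0 < x else 0 < xs ! (i - 1)))"
    by (simp add: All_less_Suc2 nth_Cons' cong: if_cong)
  then show ?case using Cons.IH[of "0 < x"] by auto
qed simp

lemma fits_pos_prefix:
  assumes "fits p xs us" "\<forall>x \<in> set xs. 0 < x"
  shows "\<forall>i < length xs. xs ! i \<le> us ! i + 1"
  using assms fits_length[OF assms(1)]
  by (subst (asm) fits_iff_nth) (auto simp: of_bool_def split: if_splits intro: order_trans)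

text \<open>In \<open>Z\<close> every entry but the first has an allowance from its left neighbour.
  After the shift every entry but the last may need one, and has it from its right neighbour, since
  \<open>y - 1\<close> is positive.\<close>

lemma fits_shift_unit:
  assumes "fits False Z us" "\<forall>x \<in> set Z. 0 < x" "no_final_one Z"
  shows "fits False (rev (shift_unit Z)) (rev us)"
  using assms(2,3)
proof (cases rule: block_cases)
  case (3 x M y)
  from fits_length[OF assms(1)] obtain u N v where us: "us = u # N @ [v]" and l: "length M = length N"
    by (cases us; cases "tl us" rule: rev_cases) (auto simp: 3)
  from assms(1) have b: "x \<le> u" "y \<le> v + 1" and M: "fits True M N"
    using 3 by (auto simp: us fits_append[OF l] of_bool_def split: if_splits)
  have "\<forall>i < length M. M ! i \<le> N ! i + 1"
    using fits_pos_prefix[OF M] 3 by blast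
  then have "fits True (rev M) (rev N)"
    using 3 l by (auto simp: fits_iff_nth rev_nth)
  then show ?thesis
    using 3 b l by (auto simp: us shift_unit_long fits_append last_rev hd_in_set)
next
  case (2 x)
  then show ?thesis using assms(1) fits_length[OF assms(1)]
    by (cases us) (auto simp: shift_unit_def)
qed (use assms(1) fits_length[OF assms(1)] in \<open>auto simp: shift_unit_def\<close>)

lemma fits_leI:
  assumes "length xs = length us" "\<And>i. i < length xs \<Longrightarrow> xs ! i \<le> us ! i"
  shows "fits p xs us"
  unfolding fits_iff_nth[OF assms(1)] using assms(2) by (blast intro: trans_le_add1)

text \<open>Shifted blocks are covered by \<open>fits_shift_unit\<close>. The exchanged
  \<open>T\<close> and \<open>0\<close> slide along the bounds, but an entry at most 1 satisfies
  every positive bound without an allowance.\<close>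

lemma fits_rev_phi:
  assumes "no_final_one d" "fits False d us" "\<forall>u \<in> set us. 0 < u"
  shows "fits False (rev (phi d)) (rev us)"
  using assms
proof (induction arbitrary: us rule: list_block_induct)
  case (block Z)
  then show ?case using fits_shift_unit[of Z us] phi_block[of Z] by simp
next
  case (step Z T R)
  define U V where "U = take (length Z) us" and "V = take (length T) (drop (length Z) us)"
  have "drop (length Z + length T) us \<noteq> []"
    using fits_length[OF step.prems(1)] by simp
  then obtain w W where w: "drop (length Z + length T) us = w # W"
    by (meson neq_Nil_conv)
  have "us = U @ V @ drop (length T) (drop (length Z) us)"
    unfolding U_def V_def by (simp only: append_take_drop_id)
  then have us: "us = U @ V @ w # W" using w by (simp add: add.commute)
  have l: "length U = length Z" "length V = length T"
    using fits_length[OF step.prems(1)] by (auto simp: U_def V_def)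
  have Z: "fits False Z U" and R: "fits False R W"
    using step.prems(1) l[symmetric] by (auto simp: us fits_append)
  have ones: "fits p (rev T @ [0]) (w # rev V)" for p
  proof (rule fits_leI)
    fix i assume i: "i < length (rev T @ [0])"
    then have "(rev T @ [0]) ! i \<in> set (rev T @ [0])" "(w # rev V) ! i \<in> set (w # rev V)"
      using l by (metis nth_mem, metis nth_mem length_append length_rev length_Cons list.size(3)
        add.commute add_Suc_right add_0_right)
    then have "(rev T @ [0]) ! i \<le> 1" "0 < (w # rev V) ! i"
      using step.hyps(3) step.prems(2) unfolding us by force+
    then show "(rev T @ [0]) ! i \<le> (w # rev V) ! i" by linarith
  qed (use l in simp)
  have "fits False (rev (phi R)) (rev W)"
    using step.IH R step.prems(2) us by simp
  moreover have "rev (phi (Z @ T @ 0 # R)) = rev (phi R) @ (rev T @ [0]) @ rev (shift_unit Z)"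
    using phi_block_0[of Z T R] step.hyps by simp
  moreover have "rev us = rev W @ (w # rev V) @ rev U"
    by (simp add: us)
  moreover have "length (rev (phi R)) = length (rev W)" "length (rev T @ [0]) = length (w # rev V)"
    using fits_length[OF R] l by auto
  \<comment> \<open>In the reversed list a \<open>0\<close> precedes this block, so the flag is
    \<open>False\<close>, as \<open>fits_shift_unit\<close> provides.\<close>
  moreover have "fits (0 < last (rev T @ [0])) (rev (shift_unit Z)) (rev U)"
    using fits_shift_unit[OF Z] step.hyps by simp
  ultimately show ?case
    using ones by (simp only: fits_append) auto
qed

section \<open>The circular map: rotation, reversal and injectivity\<close>

lemma phi_circ_pos: "\<forall>x \<in> set d. 0 < x \<Longrightarrow> phi_circ d = d"
  by (simp add: phi_circ_def)

lemma length_phi_circ [simp]: "length (phi_circ d) = length d"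
  by (auto simp: phi_circ_def Let_def)

text \<open>Reduces \<open>phi_circ\<close> to \<open>phi\<close>: once a zero is rotated to the
  end, no block wraps around.\<close>

lemma rotate_phi_circ_snoc_0:
  assumes "rotate m d = W @ [0]"
  shows "rotate m (phi_circ d) = phi (W @ [0])"
proof -
  have "d \<noteq> []" using assms by (metis append_is_Nil_conv list.distinct(1) rotate_is_Nil_conv)
  \<comment> \<open>The position in \<open>d\<close> of the final \<open>0\<close> of the rotated
    list; \<open>Suc k\<close> and \<open>m\<close> agree modulo the length.\<close>
  define k where "k = (m + length d - 1) mod length d"
  have k: "k < length d" using \<open>d \<noteq> []\<close> by (simp add: k_def)
  have "Suc k mod length d = Suc (m + length d - 1) mod length d"
    by (simp only: k_def mod_Suc_eq)
  then have mk: "m mod length d = Suc k mod length d"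
    using \<open>d \<noteq> []\<close> by simp
  have r: "rotate m xs = rotate (Suc k) xs" if "length xs = length d" for xs :: "nat list"
    using mk that by (metis rotate_conv_mod)
  have "d ! k = rotate m d ! (length d - 1)"
    using \<open>d \<noteq> []\<close> k by (subst nth_rotate) (auto simp: k_def Nat.add_diff_assoc Suc_le_eq)
  also have "\<dots> = last (rotate m d)"
    using \<open>d \<noteq> []\<close> by (simp add: last_conv_nth)
  also have "\<dots> = 0"
    by (simp add: assms)
  finally have "d ! k = 0" .
  from rotate_phi_circ[OF k this] show ?thesis
    using r[of "phi_circ d"] r[of d] assms by simp
qed

lemma inj_rotate: "inj (rotate n)"
  by (simp add: rotate_def inj_fn inj_rotate1)

lemma ends_with_0:
  assumes "0 \<in> set d"
  obtains m W where "rotate m d = W @ [0::nat]"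
proof -
  obtain P Q where "d = P @ 0 # Q" using assms by (meson split_list)
  then have "rotate (length (P @ [0])) d = (Q @ P) @ [0]"
    using rotate_append[of "P @ [0]" Q] by simp
  then show ?thesis using that by blast
qed

lemma phi_circ_rotate: "phi_circ (rotate n d) = rotate n (phi_circ d)"
proof (cases "0 \<in> set d")
  case False
  then show ?thesis using phi_circ_pos[of d] phi_circ_pos[of "rotate n d"] by (metis gr0I set_rotate)
next
  case True
  then obtain m W where W: "rotate m (rotate n d) = W @ [0]"
    using ends_with_0[of "rotate n d"] by auto
  then have "rotate (m + n) d = W @ [0]" by (simp add: rotate_rotate)
  then have "rotate m (rotate n (phi_circ d)) = phi (W @ [0])"
    using rotate_phi_circ_snoc_0 by (simp add: rotate_rotate)
  also have "\<dots> = rotate m (phi_circ (rotate n d))"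
    using rotate_phi_circ_snoc_0[OF W] by simp
  finally show ?thesis using inj_rotate by (metis injD)
qed

text \<open>Rotated to end in a zero, the sequence is \<open>Z @ T @ [0]\<close> and goes to
  \<open>phi Z @ 0 # T\<close>. Reversed and rotated until this \<open>0\<close> is last again, that
  is \<open>rev (phi Z) @ T @ [0]\<close>, which goes to \<open>rev Z @ 0 # T\<close>, a rotation of
  the reversed original.\<close>

lemma rev_phi_circ_inverse: "phi_circ (rev (phi_circ d)) = rev d"
proof (cases "0 \<in> set d")
  case False
  then show ?thesis using phi_circ_pos[of d] phi_circ_pos[of "rev d"] by (metis gr0I set_rev)
next
  case True
  then obtain m W where W: "rotate m d = W @ [0]"
    by (rule ends_with_0)
  obtain Z T where ZT: "W = Z @ T" "\<forall>x \<in> set T. x = (1::nat)" "no_final_one Z"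
    by (rule trailing_ones_decomp)
  have rT: "rev T = T" using ZT(2)
    by (metis replicate_eqI rev_replicate)
  define Y where "Y = phi Z"
  have "phi_circ (rotate m d) = phi (Z @ T @ [0])"
    using rotate_phi_circ_snoc_0[OF W] by (simp add: phi_circ_rotate ZT(1))
  also have "\<dots> = Y @ 0 # T"
    using ZT phi_snoc_ones_0 by (simp add: Y_def)
  finally have e: "rev (phi_circ (rotate m d)) = (T @ [0]) @ rev Y"
    using rT by simp
  have "rotate (length (T @ [0])) (rev (phi_circ (rotate m d))) = (rev Y @ T) @ [0]"
    unfolding e rotate_append by simp
  from rotate_phi_circ_snoc_0[OF this]
  have "rotate (length (T @ [0])) (phi_circ (rev (phi_circ (rotate m d)))) = phi (rev Y) @ 0 # T"
    using phi_snoc_ones_0[of "rev Y" T] no_final_one_rev_phi[OF ZT(3)] ZT(2) by (simp add: Y_def)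
  also have "\<dots> = rev Z @ 0 # T"
    using rev_phi_inverse[OF ZT(3)] by (simp add: Y_def)
  also have "\<dots> = rotate (length (T @ [0])) (rev (rotate m d))"
    using rotate_append[of "0 # T" "rev Z"] rT by (simp add: W ZT(1) del: rotate_Suc)
  finally have *: "phi_circ (rev (phi_circ (rotate m d))) = rev (rotate m d)"
    using inj_rotate by (metis injD)
  \<comment> \<open>Reversal turns a rotation by \<open>m\<close> into the opposite rotation;
    \<open>q\<close> represents \<open>-m\<close> modulo the length.\<close>
  define q where "q = length d - m mod length d"
  have q: "rev (rotate m xs) = rotate q (rev xs)" if "length xs = length d" for xs :: "nat list"
  proof -
    have "rotate q (rev xs) = rev (rotate (length xs - q mod length xs) xs)"
      by (rule rotate_rev)
    also have "rotate (length xs - q mod length xs) xs = rotate m xs"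
    proof (cases "m mod length d = 0")
      case False
      then have "d \<noteq> []" using True by auto
      then have "length d - q mod length d = m mod length d"
        using False by (simp add: q_def less_imp_le_nat)
      then show ?thesis
        using rotate_conv_mod[of m xs] that by simp
    qed (simp add: q_def that)
    finally show ?thesis by simp
  qed
  have "rotate q (phi_circ (rev (phi_circ d))) = rotate q (rev d)"
    using * by (simp add: phi_circ_rotate q)
  then show ?thesis using inj_rotate by (metis injD)
qed

lemma inj_phi_circ: "inj phi_circ"
  by (rule injI) (metis rev_phi_circ_inverse rev_rev_ident)

subsection \<open>The factors of a circular sequence\<close>

text \<open>The range used in \<open>factor_at\<close>: the distance from \<open>s\<close> to the
  next cut, which is \<open>s\<close> itself after a full turn if it is the only one.\<close>

definition factor_length :: "nat \<Rightarrow> nat set \<Rightarrow> nat \<Rightarrow> nat" where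
  "factor_length l C s = (LEAST k. 0 < k \<and> (s + k) mod l \<in> C)"

definition factor_start :: "nat \<Rightarrow> nat set \<Rightarrow> nat \<Rightarrow> nat" where
  "factor_start l C i = (i + l - cut_dist l C i) mod l"

text \<open>Going \<open>t\<close> steps back on the circle; adding \<open>l\<close> first keeps the
  truncated subtraction exact.\<close>

lemma mod_add_diff_mod:
  assumes "t \<le> j" "t \<le> (l::nat)"
  shows "((s + j) mod l + l - t) mod l = (s + (j - t)) mod l"
proof -
  have "((s + j) mod l + l - t) mod l = ((s + j) mod l + (l - t)) mod l"
    using assms by simp
  also have "\<dots> = (s + j + (l - t)) mod l" by (simp add: mod_add_left_eq)
  also have "s + j + (l - t) = s + (j - t) + l" using assms by simp
  finally show ?thesis by simp
qed

lemma cyc_suc_less: "i < l \<Longrightarrow> cyc_suc l i < l"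
  by (simp add: cyc_suc_def)

lemma cyc_suc_mod: "cyc_suc l (i mod l) = Suc i mod l"
  by (simp add: cyc_suc_def mod_Suc_eq)

lemma cyc_pred_suc: "i < l \<Longrightarrow> cyc_pred l (cyc_suc l i) = i"
  using mod_add_diff_mod[of 1 1 l i] by (simp add: cyc_suc_def cyc_pred_def)

lemma bij_betw_cyc_suc: "bij_betw (cyc_suc l) {..<l} {..<l}"
proof -
  have "inj_on (cyc_suc l) {..<l}"
    by (rule inj_on_inverseI[of _ "cyc_pred l"]) (simp add: cyc_pred_suc)
  then show ?thesis
    unfolding bij_betw_def by (simp add: endo_inj_surj cyc_suc_less image_subset_iff)
qed

lemma cyc_suc_surj:
  assumes "i < l"
  obtains j where "j < l" "i = cyc_suc l j"
  using bij_betw_imp_surj_on[OF bij_betw_cyc_suc[of l]] assms by (metis imageE lessThan_iff)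

lemma length_factor_at [simp]: "length (factor_at l C d s) = factor_length l C s"
  by (simp add: factor_at_def factor_length_def)

lemma nth_factor_at: "j < factor_length l C s \<Longrightarrow> factor_at l C d s ! j = d ((s + j) mod l)"
  by (simp add: factor_at_def factor_length_def)

lemma within_factor: "0 < j \<Longrightarrow> j < factor_length l C s \<Longrightarrow> (s + j) mod l \<notin> C"
  using not_less_Least[of j "\<lambda>k. 0 < k \<and> (s + k) mod l \<in> C"] unfolding factor_length_def by blast

text \<open>An index whose successor is a cut is the last one of a factor, so this is
  \<open>no_final_one\<close> for all factors at once.\<close>

abbreviation no_one_before_cut :: "nat \<Rightarrow> nat set \<Rightarrow> (nat \<Rightarrow> nat) \<Rightarrow> bool" where
  "no_one_before_cut l C d \<equiv> \<forall>i<l. cyc_suc l i \<in> C \<longrightarrow> d i \<noteq> 1"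

context
  fixes l :: nat and C :: "nat set"
  assumes C: "C \<subseteq> {..<l}" "C \<noteq> {}"
begin

lemma factor_length:
  assumes "s \<in> C"
  shows "0 < factor_length l C s" "(s + factor_length l C s) mod l \<in> C" "factor_length l C s \<le> l"
proof -
  \<comment> \<open>A full turn leads back to the cut \<open>s\<close>, so \<open>l\<close> is a
    witness and bounds the minimum.\<close>
  have *: "0 < l \<and> (s + l) mod l \<in> C" using assms C by auto
  show "0 < factor_length l C s" "(s + factor_length l C s) mod l \<in> C"
    using LeastI[of "\<lambda>k. 0 < k \<and> (s + k) mod l \<in> C", OF *] unfolding factor_length_def by auto
  show "factor_length l C s \<le> l"
    unfolding factor_length_def by (rule Least_le) (use * in simp)
qed

lemma cut_dist_factor:
  assumes "s \<in> C" "j < factor_length l C s"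
  shows "cut_dist l C ((s + j) mod l) = j"
  unfolding cut_dist_def
proof (rule Least_equality)
  have j: "j < l" using assms factor_length(3)[of s] by simp
  show "((s + j) mod l + l - j) mod l \<in> C"
    using assms j C by (subst mod_add_diff_mod) auto
  show "j \<le> t" if "((s + j) mod l + l - t) mod l \<in> C" for t
  \<comment> \<open>Fewer than \<open>j\<close> steps back from offset \<open>j\<close> end strictly
    inside the factor, where there is no cut.\<close>
  proof (rule ccontr)
    assume "\<not> j \<le> t"
    then have "(s + (j - t)) mod l \<in> C"
      using that mod_add_diff_mod[of t j l s] j by simp
    then show False
      using within_factor[of "j - t" l C s] assms \<open>\<not> j \<le> t\<close> by linarith
  qed
qed

lemma factor_start_factor:
  assumes "s \<in> C" "j < factor_length l C s"
  shows "factor_start l C ((s + j) mod l) = s"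
proof -
  have "j < l" using assms factor_length(3)[of s] by simp
  then show ?thesis
    unfolding factor_start_def cut_dist_factor[OF assms]
    using assms C by (subst mod_add_diff_mod) auto
qed

lemma factor_start:
  assumes "i < l"
  shows "factor_start l C i \<in> C" "cut_dist l C i < factor_length l C (factor_start l C i)"
    "(factor_start l C i + cut_dist l C i) mod l = i"
proof -
  obtain c where c: "c \<in> C" "c < l" using C by blast
  \<comment> \<open>Step back to the cut \<open>c\<close>, passing index 0 if \<open>c\<close> is
    greater than \<open>i\<close>.\<close>
  have ex: "\<exists>t < l. (i + l - t) mod l \<in> C"
  proof (cases "c \<le> i")
    case True
    then show ?thesis using c assms by (intro exI[of _ "i - c"]) auto
  next
    case False
    then show ?thesis using c assms by (intro exI[of _ "i + l - c"]) auto
  qed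
  then show start: "factor_start l C i \<in> C"
    unfolding factor_start_def cut_dist_def
    using LeastI_ex[of "\<lambda>t. (i + l - t) mod l \<in> C"] by blast
  have cut: "cut_dist l C i < l"
    using ex Least_le[of "\<lambda>t. (i + l - t) mod l \<in> C"] unfolding cut_dist_def
    by (meson le_less_trans)
  have shift: "(factor_start l C i + k) mod l = (i + l - (cut_dist l C i - k)) mod l"
    if "k \<le> cut_dist l C i" for k
  proof -
    have "(factor_start l C i + k) mod l = (i + l - cut_dist l C i + k) mod l"
      unfolding factor_start_def by (simp add: mod_add_left_eq)
    also have "i + l - cut_dist l C i + k = i + l - (cut_dist l C i - k)"
      using that cut by simp
    finally show ?thesis .
  qed
  show "(factor_start l C i + cut_dist l C i) mod l = i"
    using shift[OF order_refl] assms by simp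
  show "cut_dist l C i < factor_length l C (factor_start l C i)"
  \<comment> \<open>Otherwise the end of the factor, also a cut, would lie between its start and
    \<open>i\<close>, hence nearer to \<open>i\<close> than the start.\<close>
  proof (rule ccontr)
    define f where "f = factor_length l C (factor_start l C i)"
    assume "\<not> ?thesis"
    then have "f \<le> cut_dist l C i" by (simp add: f_def)
    with shift[of f] have "(i + l - (cut_dist l C i - f)) mod l \<in> C"
      using factor_length(2)[OF start] by (simp add: f_def)
    then have "cut_dist l C i \<le> cut_dist l C i - f"
      unfolding cut_dist_def by (rule Least_le)
    then show False
      using factor_length(1)[OF start] \<open>f \<le> _\<close> by (simp add: f_def)
  qed
qed

lemma factor_cases:
  assumes "i < l"
  obtains s j where "s \<in> C" "j < factor_length l C s" "i = (s + j) mod l"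
  using factor_start[OF assms] by metis

lemma phi_factors_at:
  assumes "s \<in> C" "j < factor_length l C s"
  shows "phi_factors l C d ((s + j) mod l) = phi (factor_at l C d s) ! j"
  using factor_start_factor[OF assms] cut_dist_factor[OF assms]
  unfolding phi_factors_def factor_start_def by simp

lemma factor_at_phi_factors:
  assumes "s \<in> C"
  shows "factor_at l C (phi_factors l C d) s = phi (factor_at l C d s)"
  by (rule nth_equalityI) (simp_all add: nth_factor_at phi_factors_at[OF assms])

text \<open>Start and offset form a unique address of each index below \<open>l\<close>.\<close>

lemma sum_factors: "(\<Sum>i<l. d i) = (\<Sum>s\<in>C. sum_list (factor_at l C d s))"
proof -
  have fin: "finite C" using C finite_subset by blast
  have "(\<Sum>s\<in>C. sum_list (factor_at l C d s)) = (\<Sum>s\<in>C. \<Sum>j<factor_length l C s. d ((s + j) mod l))"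
    by (rule sum.cong) (simp_all add: sum_list_sum_nth nth_factor_at atLeast0LessThan)
  also have "\<dots> = (\<Sum>(s, j) \<in> (SIGMA s:C. {..<factor_length l C s}). d ((s + j) mod l))"
    using fin by (subst sum.Sigma) auto
  also have "\<dots> = (\<Sum>i<l. d i)"
  proof (rule sum.reindex_bij_witness[of _ "\<lambda>i. (factor_start l C i, cut_dist l C i)"
        "\<lambda>(s, j). (s + j) mod l"])
    fix p assume "p \<in> (SIGMA s:C. {..<factor_length l C s})"
    then show "(factor_start l C (case p of (s, j) \<Rightarrow> (s + j) mod l),
        cut_dist l C (case p of (s, j) \<Rightarrow> (s + j) mod l)) = p"
      "(case p of (s, j) \<Rightarrow> (s + j) mod l) \<in> {..<l}"
      using C by (auto simp: factor_start_factor cut_dist_factor)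
  qed (auto simp: factor_start)
  finally show ?thesis by simp
qed

lemma no_final_one_factor:
  assumes "no_one_before_cut l C d" "s \<in> C"
  shows "no_final_one (factor_at l C d s)"
proof -
  let ?n = "factor_length l C s"
  have n: "0 < ?n" "(s + ?n) mod l \<in> C" using factor_length[OF assms(2)] by auto
  define i where "i = (s + (?n - 1)) mod l"
  have "i < l" using assms(2) C unfolding i_def by (intro mod_less_divisor) auto
  moreover have "cyc_suc l i = (s + ?n) mod l"
    using n(1) by (simp add: i_def cyc_suc_mod flip: add_Suc_right)
  moreover have "last (factor_at l C d s) = d i"
    using n(1) by (subst last_conv_nth) (auto simp: nth_factor_at i_def simp flip: length_0_conv)
  ultimately show ?thesis using assms(1)[rule_format, of i] n(2) by simp
qed

lemma sum_phi_factors: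
  assumes "no_one_before_cut l C d"
  shows "(\<Sum>i<l. phi_factors l C d i) = (\<Sum>i<l. d i)"
  unfolding sum_factors
proof (rule sum.cong[OF refl])
  fix s assume s: "s \<in> C"
  show "sum_list (factor_at l C (phi_factors l C d) s) = sum_list (factor_at l C d s)"
    unfolding factor_at_phi_factors[OF s] by (rule sum_list_phi[OF no_final_one_factor[OF assms s]])
qed

text \<open>Both sequences are cut at the same \<open>C\<close>, so the images agree factor by
  factor, and \<open>rev_phi_inverse\<close> recovers each factor.\<close>

lemma phi_factors_inj:
  assumes d: "no_one_before_cut l C d"
    and d': "no_one_before_cut l C d'"
    and eq: "\<And>i. i < l \<Longrightarrow> phi_factors l C d i = phi_factors l C d' i"
    and i: "i < l"
  shows "d i = d' i"
proof -
  from i obtain s j where s: "s \<in> C" "j < factor_length l C s" "i = (s + j) mod l"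
    by (rule factor_cases)
  have "factor_at l C (phi_factors l C d) s = factor_at l C (phi_factors l C d') s"
    by (rule nth_equalityI) (use i in \<open>simp_all add: nth_factor_at eq\<close>)
  then have "phi (factor_at l C d s) = phi (factor_at l C d' s)"
    by (simp add: factor_at_phi_factors s)
  then have "rev (factor_at l C d s) = rev (factor_at l C d' s)"
    unfolding rev_phi_inverse[OF no_final_one_factor[OF d s(1)], symmetric]
      rev_phi_inverse[OF no_final_one_factor[OF d' s(1)], symmetric] by (simp only:)
  then have "factor_at l C d s ! j = factor_at l C d' s ! j"
    by (simp only: rev_is_rev_conv)
  then show ?thesis by (simp only: nth_factor_at[OF s(2)] s(3))
qed

text \<open>A cut is the first index of its factor, and the image of a factor never starts with a
  one.\<close>

lemma phi_factors_at_cut: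
  assumes "no_one_before_cut l C d" "i \<in> C"
  shows "phi_factors l C d i \<noteq> 1"
proof -
  have "i < l" using assms(2) C by auto
  have n: "0 < factor_length l C i" using factor_length[OF assms(2)] by auto
  then have "phi (factor_at l C d i) \<noteq> []"
    by (metis length_phi length_factor_at less_numeral_extra(3) list.size(3))
  with no_final_one_rev_phi[OF no_final_one_factor[OF assms]]
  have "phi (factor_at l C d i) ! 0 \<noteq> 1"
    by (simp add: last_rev hd_conv_nth)
  then show ?thesis using phi_factors_at[OF assms(2) n, of d] \<open>i < l\<close> by simp
qed

text \<open>In \<open>d\<close> the allowance comes from the previous entry, in the image from the
  next one, and in neither case across a cut. Within one factor this is
  \<open>fits_rev_phi\<close>.\<close>

lemma phi_factors_bound:
  assumes last: "no_one_before_cut l C d"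
    and bound: "\<And>i. i < l \<Longrightarrow>
      d (cyc_suc l i) \<le> u (cyc_suc l i) + of_bool (cyc_suc l i \<notin> C \<and> 0 < d i)"
    and pos: "\<And>i. i < l \<Longrightarrow> 0 < u i"
    and i: "i < l"
  shows "phi_factors l C d i \<le>
    u i + of_bool (cyc_suc l i \<notin> C \<and> 0 < phi_factors l C d (cyc_suc l i))"
proof -
  from i obtain s j where s: "s \<in> C" "j < factor_length l C s" "i = (s + j) mod l"
    by (rule factor_cases)
  let ?D = "factor_at l C d s" and ?U = "factor_at l C u s" and ?n = "factor_length l C s"
  have "fits False ?D ?U"
  proof -
    have "?D ! k \<le> ?U ! k + of_bool (if k = 0 then False else 0 < ?D ! (k - 1))"
      if k: "k < ?n" for k
    proof (cases k)
      \<comment> \<open>A factor starts at a cut, where \<open>bound\<close> grants no allowance;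
        hence the initial flag \<open>False\<close>.\<close>
      case 0
      have "s < l" using s C by auto
      then obtain h where "h < l" "s = cyc_suc l h" by (rule cyc_suc_surj)
      then show ?thesis using bound[of h] s(1) k 0 \<open>s < l\<close> by (simp add: nth_factor_at)
    next
      case (Suc h)
      define x where "x = (s + h) mod l"
      have x: "x < l" "cyc_suc l x = (s + k) mod l"
        using i by (auto simp: x_def cyc_suc_mod Suc)
      have "d (cyc_suc l x) \<le> u (cyc_suc l x) + of_bool (0 < d x)"
        using bound[OF x(1)] by (auto simp: of_bool_def split: if_splits)
      moreover have "?D ! (k - 1) = d x"
        using k Suc by (simp add: nth_factor_at x_def)
      ultimately show ?thesis
        using k Suc by (simp add: nth_factor_at x(2))
    qed
    then show ?thesis by (subst fits_iff_nth) simp_all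
  qed
  then have f: "fits False (rev (phi ?D)) (rev ?U)"
    by (rule fits_rev_phi[OF no_final_one_factor[OF last s(1)]])
      (use pos i in \<open>auto simp: factor_at_def\<close>)
  \<comment> \<open>The place of offset \<open>j\<close> in the reversed factor. Place
    \<open>k - 1\<close> belongs to \<open>Suc j\<close>, and \<open>k = 0\<close> means that
    \<open>i\<close> ends its factor.\<close>
  define k where "k = ?n - Suc j"
  have k: "k < ?n" "?n - Suc k = j" "k > 0 \<Longrightarrow> ?n - Suc (k - 1) = Suc j"
    using s(2) by (auto simp: k_def)
  from f have "\<forall>h < ?n. rev (phi ?D) ! h \<le> rev ?U ! h +
      of_bool (if h = 0 then False else 0 < rev (phi ?D) ! (h - 1))"
    by (subst (asm) fits_iff_nth) simp_all
  from this[rule_format, OF k(1)]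
  have "phi ?D ! j \<le> ?U ! j + of_bool (if k = 0 then False else 0 < rev (phi ?D) ! (k - 1))"
    using k(1,2) by (simp add: rev_nth)
  moreover have "rev (phi ?D) ! (k - 1) = phi ?D ! Suc j" if "k \<noteq> 0"
    using k that by (subst rev_nth) simp_all
  moreover have "k \<noteq> 0 \<Longrightarrow> Suc j < ?n"
    by (simp add: k_def)
  ultimately have "phi ?D ! j \<le> ?U ! j + of_bool (Suc j < ?n \<and> 0 < phi ?D ! Suc j)"
    by (cases "k = 0") simp_all
  moreover have "phi_factors l C d i = phi ?D ! j" "?U ! j = u i"
    using s by (auto simp: phi_factors_at nth_factor_at)
  moreover have "cyc_suc l i \<notin> C \<and> phi_factors l C d (cyc_suc l i) = phi ?D ! Suc j" if "Suc j < ?n"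
    using within_factor[of "Suc j" l C s] phi_factors_at[OF s(1) that, of d] that
    by (simp add: s(3) cyc_suc_mod)
  ultimately show ?thesis by (cases "Suc j < ?n") auto
qed

end

text \<open>A single cut after the zero at \<open>k\<close> leaves one factor of length
  \<open>l\<close>, the list rotated so that this zero comes last; there the circular map is the
  linear one.\<close>

lemma phi_circ_eq_phi_factors:
  assumes "k < l" "d k = 0" "i < l"
  shows "phi_circ (map d [0..<l]) ! i = phi_factors l {cyc_suc l k} d i"
proof -
  let ?s = "cyc_suc l k"
  have C: "{?s} \<subseteq> {..<l}" "{?s} \<noteq> {}" using assms by (auto simp: cyc_suc_less)
  have "factor_length l {?s} ?s = l"
    unfolding factor_length_def
  proof (rule Least_equality)
    \<comment> \<open>The only cut is \<open>?s\<close> itself, reached again only after a multiple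
      of \<open>l\<close> steps.\<close>
    show "l \<le> n" if "0 < n \<and> (?s + n) mod l \<in> {?s}" for n
    proof -
      have "(?s + n) mod l = (?s + 0) mod l" using that by (auto simp: cyc_suc_def)
      then have "l dvd n" using mod_eq_dvd_iff_nat[of ?s "?s + n" l] by simp
      then show ?thesis using that by (auto dest: dvd_imp_le)
    qed
  qed (use assms in \<open>auto simp: cyc_suc_def\<close>)
  then have f: "factor_at l {?s} d ?s = rotate (Suc k) (map d [0..<l])"
  proof (intro nth_equalityI)
    fix h assume "h < length (factor_at l {?s} d ?s)"
    then have h: "h < factor_length l {?s} ?s" "h < l"
      using \<open>factor_length l {?s} ?s = l\<close> by (simp_all add: C)
    show "factor_at l {?s} d ?s ! h = rotate (Suc k) (map d [0..<l]) ! h"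
      unfolding nth_factor_at[OF h(1)] using h(2)
      by (simp add: nth_rotate cyc_suc_def mod_add_left_eq del: rotate_Suc)
  qed (simp add: C \<open>factor_length l {?s} ?s = l\<close>)
  obtain s j where "s \<in> {?s}" "j < factor_length l {?s} s" "i = (s + j) mod l"
    by (rule factor_cases[OF C assms(3)])
  then have j: "j < l" "i = (?s + j) mod l"
    using \<open>factor_length l {?s} ?s = l\<close> by auto
  then have "phi_factors l {?s} d i = phi (rotate (Suc k) (map d [0..<l])) ! j"
    using phi_factors_at[OF C, of ?s j d] \<open>factor_length l {?s} ?s = l\<close> f by simp
  also have "\<dots> = rotate (Suc k) (phi_circ (map d [0..<l])) ! j"
    using assms by (subst rotate_phi_circ) simp_all
  also have "\<dots> = phi_circ (map d [0..<l]) ! ((Suc k + j) mod l)"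
    using j by (subst nth_rotate) simp_all
  also have "(Suc k + j) mod l = i"
    using j by (simp add: cyc_suc_def mod_add_left_eq)
  finally show ?thesis by simp
qed

subsection \<open>Codes of ideals and filters\<close>

definition delta :: "nat list \<Rightarrow> nat \<Rightarrow> nat" where
  "delta \<beta> i = \<beta> ! (2 * i + 1)"

text \<open>Ascending chain \<open>j\<close> starts at the bottom of \<open>D_seg \<beta> i\<close>
  and ends at the top of \<open>D_seg \<beta> j\<close>. An interior element forces the bottom into
  an ideal; a full \<open>D_seg \<beta> j\<close> contains the top and forces the whole
  chain.\<close>

definition lower_code :: "nat list \<Rightarrow> ideal_code \<Rightarrow> bool" where
  "lower_code \<beta> = (\<lambda>(a, d). \<forall>i < half \<beta>. let j = cyc_suc (half \<beta>) i in
     a j \<le> alpha \<beta> j - 1 \<and> d i \<le> delta \<beta> i + 1 \<and> (0 < a j \<longrightarrow> 0 < d i) \<and>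
     (d j = delta \<beta> j + 1 \<longrightarrow> a j = alpha \<beta> j - 1 \<and> 0 < d i))"

text \<open>Dually, an interior element of chain \<open>i\<close> forces its top, which lies on
  \<open>D_seg \<beta> i\<close>; a full \<open>D_seg \<beta> i\<close> contains the bottom of chain
  \<open>j\<close> and forces all of that chain.\<close>

definition upper_code :: "nat list \<Rightarrow> ideal_code \<Rightarrow> bool" where
  "upper_code \<beta> = (\<lambda>(b, e). \<forall>i < half \<beta>. let j = cyc_suc (half \<beta>) i in
     b i \<le> alpha \<beta> i - 1 \<and> e i \<le> delta \<beta> i + 1 \<and> (0 < b i \<longrightarrow> 0 < e i) \<and>
     (e i = delta \<beta> i + 1 \<longrightarrow> b j = alpha \<beta> j - 1 \<and> 0 < e j))"

text \<open>The images of the lower codes under \<open>PHC1\<close> and of the upper codes under the inverse of \<open>PHC3\<close>.\<close>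

definition lower_mid_code :: "nat list \<Rightarrow> ideal_code \<Rightarrow> bool" where
  "lower_mid_code \<beta> = (\<lambda>(a, d). \<forall>i < half \<beta>. let j = cyc_suc (half \<beta>) i in
     a j \<le> alpha \<beta> j - 1 \<and> (d i = 1 \<longrightarrow> a j = alpha \<beta> j - 1) \<and>
     d j \<le> delta \<beta> j + of_bool (a j = alpha \<beta> j - 1 \<and> 0 < d i))"

definition upper_mid_code :: "nat list \<Rightarrow> ideal_code \<Rightarrow> bool" where
  "upper_mid_code \<beta> = (\<lambda>(b, e). \<forall>i < half \<beta>. let j = cyc_suc (half \<beta>) i in
     b i \<le> alpha \<beta> i - 1 \<and> (e i = 1 \<longrightarrow> b i = alpha \<beta> i - 1) \<and>
     e i \<le> delta \<beta> i + of_bool (b j = alpha \<beta> j - 1 \<and> 0 < e j))"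

definition code_eq :: "nat list \<Rightarrow> ideal_code \<Rightarrow> ideal_code \<Rightarrow> bool" where
  "code_eq \<beta> c c' \<longleftrightarrow> (\<forall>i < half \<beta>. fst c i = fst c' i \<and> snd c i = snd c' i)"

definition code_size :: "nat list \<Rightarrow> ideal_code \<Rightarrow> nat" where
  "code_size \<beta> c = (\<Sum>i < half \<beta>. fst c i + snd c i)"

lemma delta_pos: "composition \<beta> \<Longrightarrow> i < half \<beta> \<Longrightarrow> 0 < delta \<beta> i"
  unfolding composition_def delta_def by (auto intro!: nth_mem)

lemma all_cyc_suc: "(\<forall>i<l. P (cyc_suc l i)) \<longleftrightarrow> (\<forall>i<l. P i)"
  using cyc_suc_surj cyc_suc_less by metis

lemma sum_cyc_suc: "(\<Sum>i<l. f (cyc_suc l i)) = (\<Sum>i<l. f i)"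
  by (rule sum.reindex_bij_betw[OF bij_betw_cyc_suc])

text \<open>Pairs the two values between which \<open>PHC1\<close> moves a unit.\<close>

lemma code_size_cyc_suc:
  "code_size \<beta> c = (\<Sum>i < half \<beta>. fst c (cyc_suc (half \<beta>) i) + snd c i)"
  unfolding code_size_def sum.distrib by (simp add: sum_cyc_suc)

section \<open>The steps (PHC1) and (PHC3), which move single units\<close>

lemma PHC1_values:
  fixes \<beta> a d
  defines "l \<equiv> half \<beta>"
  assumes "i < l"
  shows "fst (PHC1 \<beta> (a, d)) (cyc_suc l i) =
      (if d i = 1 \<and> a (cyc_suc l i) < alpha \<beta> (cyc_suc l i) - 1
       then a (cyc_suc l i) + 1 else a (cyc_suc l i))"
    "snd (PHC1 \<beta> (a, d)) i =
      (if d i = 1 \<and> a (cyc_suc l i) < alpha \<beta> (cyc_suc l i) - 1 then 0 else d i)"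
  using assms by (auto simp: PHC1_def Let_def cyc_pred_suc)

text \<open>A one that remains in \<open>d\<close> has a maximal value of \<open>a\<close> after it.
  If \<open>d j\<close> exceeds \<open>delta \<beta> j\<close>, then \<open>a j\<close> was maximal
  already, so \<open>d i\<close> gave no unit away and is still positive.\<close>

lemma PHC1_lower_mid_code:
  assumes "composition \<beta>" "lower_code \<beta> c"
  shows "lower_mid_code \<beta> (PHC1 \<beta> c)"
proof -
  obtain a d where c: "c = (a, d)" by fastforce
  obtain a' d' where c': "PHC1 \<beta> c = (a', d')" by fastforce
  let ?l = "half \<beta>"
  have "a' j \<le> alpha \<beta> j - 1 \<and> (d' i = 1 \<longrightarrow> a' j = alpha \<beta> j - 1) \<and>
     d' j \<le> delta \<beta> j + of_bool (a' j = alpha \<beta> j - 1 \<and> 0 < d' i)"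
    if i: "i < ?l" and j: "j = cyc_suc ?l i" for i j
  proof -
    have j': "j < ?l" using i j by (simp add: cyc_suc_less)
    have v: "a' j = (if d i = 1 \<and> a j < alpha \<beta> j - 1 then a j + 1 else a j)"
      "d' i = (if d i = 1 \<and> a j < alpha \<beta> j - 1 then 0 else d i)" "d' j \<le> d j"
      using PHC1_values[OF i, of a d] PHC1_values(2)[OF j', of a d] c c' j
      by (auto split: if_splits)
    have "a j \<le> alpha \<beta> j - 1" "0 < a j \<longrightarrow> 0 < d i" "d j \<le> delta \<beta> j + 1"
        "d j = delta \<beta> j + 1 \<longrightarrow> a j = alpha \<beta> j - 1 \<and> 0 < d i"
      using assms(2) i j j' unfolding lower_code_def c by (auto simp: Let_def)
    with v show ?thesis by (cases "d j = delta \<beta> j + 1") (auto split: if_splits)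
  qed
  then show ?thesis unfolding lower_mid_code_def c' by (simp add: Let_def)
qed

text \<open>Here \<open>p\<close> is a value of \<open>d\<close> and \<open>q\<close> the next value
  of \<open>a\<close>. A move leaves \<open>0\<close> and a positive number, whereas an unmoved pair
  with \<open>p = 0\<close> has \<open>q = 0\<close>; so the image shows whether there was a
  move.\<close>

lemma move_unit_inj:
  fixes p q p' q' M :: nat
  assumes "(if p = 1 \<and> q < M then q + 1 else q) = (if p' = 1 \<and> q' < M then q' + 1 else q')"
    and "(if p = 1 \<and> q < M then 0 else p) = (if p' = 1 \<and> q' < M then 0 else p')"
    and "q \<le> M" "0 < q \<longrightarrow> 0 < p" "q' \<le> M" "0 < q' \<longrightarrow> 0 < p'"
  shows "q = q' \<and> p = p'"
proof -
  consider "p = 1 \<and> q < M" "p' = 1 \<and> q' < M" | "p = 1 \<and> q < M" "\<not> (p' = 1 \<and> q' < M)"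
    | "\<not> (p = 1 \<and> q < M)" "p' = 1 \<and> q' < M" | "\<not> (p = 1 \<and> q < M)" "\<not> (p' = 1 \<and> q' < M)"
    by blast
  then show ?thesis
  proof cases
    case 1
    show ?thesis using assms(1) 1 unfolding if_P[OF 1(1)] if_P[OF 1(2)] by simp
  next
    case 2
    show ?thesis using assms(1,2,6) unfolding if_P[OF 2(1)] if_not_P[OF 2(2)] by linarith
  next
    case 3
    show ?thesis using assms(1,2,4) unfolding if_not_P[OF 3(1)] if_P[OF 3(2)] by linarith
  next
    case 4
    show ?thesis using assms(1,2) unfolding if_not_P[OF 4(1)] if_not_P[OF 4(2)] by (rule conjI)
  qed
qed

lemma PHC1_inj:
  assumes "lower_code \<beta> c" "lower_code \<beta> c'" "code_eq \<beta> (PHC1 \<beta> c) (PHC1 \<beta> c')"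
  shows "code_eq \<beta> c c'"
proof -
  obtain a d where c: "c = (a, d)" by fastforce
  obtain a' d' where c': "c' = (a', d')" by fastforce
  let ?l = "half \<beta>"
  have "a j = a' j \<and> d i = d' i" if i: "i < ?l" and j: "j = cyc_suc ?l i" for i j
  proof -
    have "j < ?l" using i j by (simp add: cyc_suc_less)
    then have "fst (PHC1 \<beta> (a, d)) j = fst (PHC1 \<beta> (a', d')) j"
      "snd (PHC1 \<beta> (a, d)) i = snd (PHC1 \<beta> (a', d')) i"
      using assms(3) i by (auto simp: code_eq_def c c')
    moreover have "a j \<le> alpha \<beta> j - 1" "0 < a j \<longrightarrow> 0 < d i"
        "a' j \<le> alpha \<beta> j - 1" "0 < a' j \<longrightarrow> 0 < d' i"
      using assms(1,2) i j unfolding lower_code_def c c' by (auto simp: Let_def)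
    ultimately show ?thesis
      unfolding PHC1_values[OF i, folded j] by (rule move_unit_inj)
  qed
  then have "\<forall>i<?l. a (cyc_suc ?l i) = a' (cyc_suc ?l i)" "\<forall>i<?l. d i = d' i"
    by blast+
  then show ?thesis
    unfolding code_eq_def c c' using all_cyc_suc[of ?l "\<lambda>i. a i = a' i"] by simp
qed

lemma code_size_PHC1: "code_size \<beta> (PHC1 \<beta> c) = code_size \<beta> c"
  unfolding code_size_cyc_suc
  by (cases c) (auto intro!: sum.cong simp: PHC1_values)

text \<open>A unit gained makes \<open>e i\<close> equal to 1, which is less than
  \<open>delta \<beta> i + 1\<close>. So if \<open>e i\<close> is full afterwards, it was full
  before; then \<open>e j\<close> was positive, and \<open>PHC3\<close> leaves index
  \<open>j\<close> alone.\<close>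

lemma PHC3_upper_code:
  assumes "composition \<beta>" "upper_mid_code \<beta> c"
  shows "upper_code \<beta> (PHC3 c)"
proof -
  obtain b e where c: "c = (b, e)" by fastforce
  let ?l = "half \<beta>"
  let ?b = "\<lambda>i. if e i = 0 \<and> 0 < b i then b i - 1 else b i"
    and ?e = "\<lambda>i. if e i = 0 \<and> 0 < b i then 1 else e i"
  have "?b i \<le> alpha \<beta> i - 1 \<and> ?e i \<le> delta \<beta> i + 1 \<and> (0 < ?b i \<longrightarrow> 0 < ?e i) \<and>
     (?e i = delta \<beta> i + 1 \<longrightarrow> ?b j = alpha \<beta> j - 1 \<and> 0 < ?e j)"
    if i: "i < ?l" and j: "j = cyc_suc ?l i" for i j
  proof -
    have "b i \<le> alpha \<beta> i - 1" "e i \<le> delta \<beta> i + of_bool (b j = alpha \<beta> j - 1 \<and> 0 < e j)"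
      using assms(2) i j unfolding upper_mid_code_def c by (auto simp: Let_def)
    with delta_pos[OF assms(1) i] show ?thesis
      by (auto simp: of_bool_def split: if_splits)
  qed
  then show ?thesis unfolding upper_code_def PHC3_def c by (simp add: Let_def)
qed

text \<open>Here \<open>p\<close> is a value of \<open>e\<close> and \<open>q\<close> the value of
  \<open>b\<close> at the same index. A changed pair ends as \<open>1\<close> with a number below
  \<open>M\<close>, whereas an unchanged pair with \<open>p = 1\<close> has
  \<open>q = M\<close>.\<close>

lemma take_unit_inj:
  fixes p q p' q' M :: nat
  assumes "(if p = 0 \<and> 0 < q then q - 1 else q) = (if p' = 0 \<and> 0 < q' then q' - 1 else q')"
    and "(if p = 0 \<and> 0 < q then 1 else p) = (if p' = 0 \<and> 0 < q' then 1 else p')"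
    and "q \<le> M" "p = 1 \<longrightarrow> q = M" "q' \<le> M" "p' = 1 \<longrightarrow> q' = M"
  shows "q = q' \<and> p = p'"
proof -
  consider "p = 0 \<and> 0 < q" "p' = 0 \<and> 0 < q'" | "p = 0 \<and> 0 < q" "\<not> (p' = 0 \<and> 0 < q')"
    | "\<not> (p = 0 \<and> 0 < q)" "p' = 0 \<and> 0 < q'" | "\<not> (p = 0 \<and> 0 < q)" "\<not> (p' = 0 \<and> 0 < q')"
    by blast
  then show ?thesis
  proof cases
    case 1
    show ?thesis using assms(1) 1 unfolding if_P[OF 1(1)] if_P[OF 1(2)] by linarith
  next
    case 2
    show ?thesis using assms(1,2,3,6) 2(1) unfolding if_P[OF 2(1)] if_not_P[OF 2(2)] by linarith
  next
    case 3
    show ?thesis using assms(1,2,4,5) 3(2) unfolding if_not_P[OF 3(1)] if_P[OF 3(2)] by linarith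
  next
    case 4
    show ?thesis using assms(1,2) unfolding if_not_P[OF 4(1)] if_not_P[OF 4(2)] by (rule conjI)
  qed
qed

lemma PHC3_inj:
  assumes "upper_mid_code \<beta> c" "upper_mid_code \<beta> c'" "code_eq \<beta> (PHC3 c) (PHC3 c')"
  shows "code_eq \<beta> c c'"
proof -
  obtain b e where c: "c = (b, e)" by fastforce
  obtain b' e' where c': "c' = (b', e')" by fastforce
  have "b i = b' i \<and> e i = e' i" if i: "i < half \<beta>" for i
  proof -
    have "b i \<le> alpha \<beta> i - 1" "e i = 1 \<longrightarrow> b i = alpha \<beta> i - 1"
      "b' i \<le> alpha \<beta> i - 1" "e' i = 1 \<longrightarrow> b' i = alpha \<beta> i - 1"
      using assms(1,2) i unfolding upper_mid_code_def c c' by (auto simp: Let_def)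
    moreover have "(if e i = 0 \<and> 0 < b i then b i - 1 else b i) =
        (if e' i = 0 \<and> 0 < b' i then b' i - 1 else b' i)"
      "(if e i = 0 \<and> 0 < b i then 1 else e i) = (if e' i = 0 \<and> 0 < b' i then 1 else e' i)"
      using assms(3) i by (simp_all add: code_eq_def PHC3_def c c' cong: if_cong)
    ultimately show ?thesis
      by (intro take_unit_inj)
  qed
  then show ?thesis unfolding code_eq_def c c' by simp
qed

lemma code_size_PHC3: "code_size \<beta> (PHC3 c) = code_size \<beta> c"
  unfolding code_size_def PHC3_def by (cases c) (auto intro!: sum.cong)

section \<open>The step (PHC2)\<close>

lemma PHC2_cut:
  fixes \<beta> a
  defines "C \<equiv> {i. i < half \<beta> \<and> a i < alpha \<beta> i - 1}"
  assumes "C \<noteq> {}"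
  shows "PHC2 \<beta> (a, d) = (a, phi_factors (half \<beta>) C d)"
  using assms by (simp add: PHC2_def Let_def)

lemma PHC2_circ:
  assumes "\<And>i. i < half \<beta> \<Longrightarrow> \<not> a i < alpha \<beta> i - 1"
  shows "PHC2 \<beta> (a, d) = (a, \<lambda>i. phi_circ (map d [0..<half \<beta>]) ! i)"
proof -
  have *: "{i. i < half \<beta> \<and> a i < alpha \<beta> i - 1} = {}" using assms by blast
  show ?thesis unfolding PHC2_def Let_def prod.case * by simp
qed

text \<open>
  Unless \<open>PHC2\<close> does nothing, it applies \<open>phi\<close> to linear factors: in the case of the circular
  map, cutting after a zero yields a single factor.
\<close>

lemma PHC2_cases:
  fixes \<beta> a d
  defines "l \<equiv> half \<beta>"
  assumes mid: "lower_mid_code \<beta> (a, d)"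
  obtains e where "PHC2 \<beta> (a, d) = (a, e)" "\<And>i. i < l \<Longrightarrow> a i = alpha \<beta> i - 1"
      "\<And>i. i < l \<Longrightarrow> 0 < d i" "\<And>i. i < l \<Longrightarrow> e i = d i"
  | e C where "PHC2 \<beta> (a, d) = (a, e)" "C \<subseteq> {..<l}" "C \<noteq> {}"
      "\<And>i. i < l \<Longrightarrow> e i = phi_factors l C d i" "{i. i < l \<and> a i < alpha \<beta> i - 1} \<subseteq> C"
      "no_one_before_cut l C d"
      "\<And>i. i < l \<Longrightarrow> d (cyc_suc l i) \<le>
        delta \<beta> (cyc_suc l i) + of_bool (cyc_suc l i \<notin> C \<and> 0 < d i)"
proof -
  define C where "C = {i. i < l \<and> a i < alpha \<beta> i - 1}"
  have one: "d i = 1 \<Longrightarrow> a (cyc_suc l i) = alpha \<beta> (cyc_suc l i) - 1"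
    and bd: "d (cyc_suc l i) \<le> delta \<beta> (cyc_suc l i) +
      of_bool (a (cyc_suc l i) = alpha \<beta> (cyc_suc l i) - 1 \<and> 0 < d i)"
    and le: "a (cyc_suc l i) \<le> alpha \<beta> (cyc_suc l i) - 1"
    if "i < l" for i
    using mid that unfolding lower_mid_code_def l_def by (auto simp: Let_def)
  have a_le: "a i \<le> alpha \<beta> i - 1" if "i < l" for i
    using le that all_cyc_suc[of l "\<lambda>i. a i \<le> alpha \<beta> i - 1"] by blast
  have bdC: "d (cyc_suc l i) \<le> delta \<beta> (cyc_suc l i) + of_bool (cyc_suc l i \<notin> C \<and> 0 < d i)"
    if "i < l" for i
    using bd[OF that] cyc_suc_less[OF that] by (auto simp: C_def of_bool_def split: if_splits)
  show thesis
  proof (cases "C = {}")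
    case False
    show ?thesis
    proof (rule that(2)[of "phi_factors l C d" C])
      show "PHC2 \<beta> (a, d) = (a, phi_factors l C d)"
        using False PHC2_cut[of \<beta> a d] by (simp add: C_def l_def)
      show "no_one_before_cut l C d"
        using one by (fastforce simp: C_def)
    qed (use False bdC in \<open>auto simp: C_def\<close>)
  next
    case True
    have e: "PHC2 \<beta> (a, d) = (a, \<lambda>i. phi_circ (map d [0..<l]) ! i)"
      unfolding l_def by (rule PHC2_circ) (use True in \<open>auto simp: C_def l_def\<close>)
    show ?thesis
    proof (cases "\<forall>i<l. 0 < d i")
      case pos: True
      then have "phi_circ (map d [0..<l]) = map d [0..<l]"
        by (intro phi_circ_pos) auto
      then show ?thesis
        using that(1)[OF e] True a_le pos by (force simp: C_def)
    next
      case False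
      then obtain k where k: "k < l" "d k = 0" by auto
      have inj: "i = k" if "cyc_suc l i = cyc_suc l k" "i < l" for i
        using that k cyc_pred_suc by metis
      show ?thesis
      \<comment> \<open>The cut after the zero at \<open>k\<close> is harmless: the factor ends in
        \<open>0\<close>, and the entry after this zero had no allowance to lose.\<close>
      proof (rule that(2)[OF e, of "{cyc_suc l k}"])
        show "no_one_before_cut l {cyc_suc l k} d"
          using inj k by fastforce
        show "d (cyc_suc l i) \<le> delta \<beta> (cyc_suc l i) +
            of_bool (cyc_suc l i \<notin> {cyc_suc l k} \<and> 0 < d i)" if "i < l" for i
          using bdC[OF that] inj[OF _ that] k
          by (cases "i = k") (auto simp: of_bool_def split: if_splits)
      qed (use True k phi_circ_eq_phi_factors[of k l d] in \<open>auto simp: C_def cyc_suc_less\<close>)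
    qed
  qed
qed

text \<open>An index where \<open>a\<close> is not maximal is a cut, so its new entry is not 1; and
  an allowance, never crossing a cut, comes only from an index where \<open>a\<close> is maximal. If
  \<open>PHC2\<close> changes nothing, all values of \<open>a\<close> are maximal and all entries
  positive, so the allowance is available from both sides.\<close>

lemma PHC2_upper_mid_code:
  assumes "composition \<beta>" "lower_mid_code \<beta> c"
  shows "upper_mid_code \<beta> (PHC2 \<beta> c)"
proof -
  obtain a d where c: "c = (a, d)" by fastforce
  let ?l = "half \<beta>"
  have le: "a i \<le> alpha \<beta> i - 1" if "i < ?l" for i
  proof -
    from that obtain j where "j < ?l" "i = cyc_suc ?l j" by (rule cyc_suc_surj)
    then show ?thesis using assms(2) unfolding lower_mid_code_def c by (auto simp: Let_def)
  qed
  have bd: "d (cyc_suc ?l i) \<le> delta \<beta> (cyc_suc ?l i) + 1" if "i < ?l" for i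
    using assms(2) that unfolding lower_mid_code_def c
    by (auto simp: Let_def of_bool_def split: if_splits)
  from assms(2) have "lower_mid_code \<beta> (a, d)" by (simp add: c)
  then show ?thesis
  proof (cases rule: PHC2_cases)
    case (1 e)
    have "e i \<le> delta \<beta> i + 1" if "i < ?l" for i
      using bd 1(4)[OF that] that all_cyc_suc[of ?l "\<lambda>i. d i \<le> delta \<beta> i + 1"] by auto
    then show ?thesis
      using 1 by (simp add: c upper_mid_code_def Let_def cyc_suc_less)
  next
    case (2 e C)
    have cut: "e i \<noteq> 1" if "i \<in> C" for i
      using phi_factors_at_cut[OF 2(2,3,6) that] 2(2,4) that by auto
    have bound: "e i \<le> delta \<beta> i + of_bool (cyc_suc ?l i \<notin> C \<and> 0 < e (cyc_suc ?l i))"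
      if "i < ?l" for i
      unfolding 2(4)[OF that] 2(4)[OF cyc_suc_less[OF that]]
      by (rule phi_factors_bound[OF 2(2,3,6,7) _ that]) (assumption, rule delta_pos[OF assms(1)])
    have inC: "i \<in> C" if "i < ?l" "a i \<noteq> alpha \<beta> i - 1" for i
      using 2(5) le[OF that(1)] that by auto
    have "a i \<le> alpha \<beta> i - 1 \<and> (e i = 1 \<longrightarrow> a i = alpha \<beta> i - 1) \<and> e i \<le> delta \<beta> i +
        of_bool (a (cyc_suc ?l i) = alpha \<beta> (cyc_suc ?l i) - 1 \<and> 0 < e (cyc_suc ?l i))"
      if "i < ?l" for i
    proof -
      let ?j = "cyc_suc ?l i"
      have "of_bool (?j \<notin> C \<and> 0 < e ?j) \<le> (of_bool (a ?j = alpha \<beta> ?j - 1 \<and> 0 < e ?j) :: nat)"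
        using inC[OF cyc_suc_less[OF that]] by (auto simp: of_bool_def)
      then have "e i \<le> delta \<beta> i + of_bool (a ?j = alpha \<beta> ?j - 1 \<and> 0 < e ?j)"
        using bound[OF that] by linarith
      then show ?thesis
        using le[OF that] cut[of i] inC[OF that] by blast
    qed
    then show ?thesis
      using 2(1) by (simp add: c upper_mid_code_def Let_def)
  qed
qed

lemma code_size_PHC2:
  assumes "lower_mid_code \<beta> c"
  shows "code_size \<beta> (PHC2 \<beta> c) = code_size \<beta> c"
proof -
  obtain a d where c: "c = (a, d)" by fastforce
  from assms have "lower_mid_code \<beta> (a, d)" by (simp add: c)
  then show ?thesis
  proof (cases rule: PHC2_cases)
    case (2 e C)
    then show ?thesis
      using sum_phi_factors[OF 2(2,3,6)] by (simp add: c code_size_def sum.distrib)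
  qed (simp add: c code_size_def)
qed

text \<open>The cut after a zero in \<open>PHC2_cases\<close> depends on \<open>d\<close> and may
  differ for the two codes. The cuts of (PHC2) itself depend only on \<open>a\<close>, which is
  unchanged and thus common to both; without such cuts, injectivity of \<open>phi_circ\<close> is
  used directly.\<close>

lemma PHC2_inj:
  assumes mid: "lower_mid_code \<beta> c" "lower_mid_code \<beta> c'"
    and eq: "code_eq \<beta> (PHC2 \<beta> c) (PHC2 \<beta> c')"
  shows "code_eq \<beta> c c'"
proof -
  obtain a d where c: "c = (a, d)" by fastforce
  obtain a' d' where c': "c' = (a', d')" by fastforce
  let ?l = "half \<beta>"
  let ?C = "{i. i < ?l \<and> a i < alpha \<beta> i - 1}"
  have "fst (PHC2 \<beta> (x, y)) = x" for x y by (simp add: PHC2_def Let_def)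
  then have a: "a i = a' i" if "i < ?l" for i
    using eq that by (simp add: code_eq_def c c')
  then have C: "{i. i < ?l \<and> a' i < alpha \<beta> i - 1} = ?C" by auto
  show ?thesis
  proof (cases "?C = {}")
    case True
    have "PHC2 \<beta> (a, d) = (a, \<lambda>i. phi_circ (map d [0..<?l]) ! i)"
      by (rule PHC2_circ) (use True in auto)
    moreover have "PHC2 \<beta> (a', d') = (a', \<lambda>i. phi_circ (map d' [0..<?l]) ! i)"
      by (rule PHC2_circ) (use True C in auto)
    ultimately have "phi_circ (map d [0..<?l]) ! i = phi_circ (map d' [0..<?l]) ! i" if "i < ?l" for i
      using eq that by (simp add: code_eq_def c c')
    then have "phi_circ (map d [0..<?l]) = phi_circ (map d' [0..<?l])"
      by (intro nth_equalityI) auto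
    then have "map d [0..<?l] = map d' [0..<?l]"
      by (rule injD[OF inj_phi_circ])
    then show ?thesis using a by (simp add: code_eq_def c c')
  next
    case False
    have n: "no_one_before_cut ?l ?C x" if "lower_mid_code \<beta> (a, x) \<or> lower_mid_code \<beta> (a', x)" for x
      using that a unfolding lower_mid_code_def by (auto simp: Let_def cyc_suc_less)
    have p: "PHC2 \<beta> (a, d) = (a, phi_factors ?l ?C d)"
      using PHC2_cut[OF False] .
    have p': "PHC2 \<beta> (a', d') = (a', phi_factors ?l ?C d')"
      using PHC2_cut[of \<beta> a' d'] False unfolding C by blast
    have "d i = d' i" if "i < ?l" for i
    proof (rule phi_factors_inj[OF _ False _ _ _ that])
      show "phi_factors ?l ?C d i = phi_factors ?l ?C d' i" if "i < ?l" for i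
        using eq that unfolding code_eq_def c c' p p' by simp
    qed (use n mid in \<open>auto simp: c c'\<close>)
    then show ?thesis using a by (simp add: code_eq_def c c')
  qed
qed

section \<open>The composed map on codes\<close>

lemma PHC_upper_code:
  "composition \<beta> \<Longrightarrow> lower_code \<beta> c \<Longrightarrow> upper_code \<beta> (PHC \<beta> c)"
  unfolding PHC_def by (intro PHC3_upper_code PHC2_upper_mid_code PHC1_lower_mid_code)

lemma code_size_PHC:
  "composition \<beta> \<Longrightarrow> lower_code \<beta> c \<Longrightarrow> code_size \<beta> (PHC \<beta> c) = code_size \<beta> c"
  unfolding PHC_def by (simp add: code_size_PHC3 code_size_PHC2 code_size_PHC1 PHC1_lower_mid_code)

lemma PHC_inj:
  assumes "composition \<beta>" "lower_code \<beta> c" "lower_code \<beta> c'"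
    and "code_eq \<beta> (PHC \<beta> c) (PHC \<beta> c')"
  shows "code_eq \<beta> c c'"
proof -
  have m: "lower_mid_code \<beta> (PHC1 \<beta> c)" "lower_mid_code \<beta> (PHC1 \<beta> c')"
    using assms by (blast intro: PHC1_lower_mid_code)+
  from assms(4) have "code_eq \<beta> (PHC2 \<beta> (PHC1 \<beta> c)) (PHC2 \<beta> (PHC1 \<beta> c'))"
    unfolding PHC_def by (rule PHC3_inj[OF m[THEN PHC2_upper_mid_code[OF assms(1)]]])
  then show ?thesis
    by (rule PHC1_inj[OF assms(2,3) PHC2_inj[OF m]])
qed

subsection \<open>The circular fence\<close>

lemma initial_segment_card:
  fixes S :: "nat set"
  assumes "finite S" "S \<subseteq> {a..}" "\<And>j k. j \<in> S \<Longrightarrow> a \<le> k \<Longrightarrow> k \<le> j \<Longrightarrow> k \<in> S"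
  shows "S = {a..<a + card S}"
proof (cases "S = {}")
  case False
  define m where "m = Max S"
  have "S = {a..m}"
  proof (intro equalityI subsetI)
    show "x \<in> {a..m}" if "x \<in> S" for x
      using that assms(2) Max_ge[OF assms(1)] by (auto simp: m_def)
    show "x \<in> S" if "x \<in> {a..m}" for x
      using that assms(3)[OF Max_in[OF assms(1) False]] by (simp add: m_def)
  qed
  moreover have "a \<le> m"
    using Max_in[OF assms(1) False] assms(2) unfolding m_def by auto
  ultimately show ?thesis by auto
qed simp

text \<open>The position, before gluing, where an ascending segment meets the descending one after
  it.\<close>

definition top_pos :: "nat list \<Rightarrow> nat \<Rightarrow> nat" where
  "top_pos \<beta> i = sum_list (take (2 * i + 1) \<beta>)"

text \<open>
  Both segments ending in the \<open>i\<close>-th maximal element are indexed by the distance from it,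
  so that filters correspond to initial segments.
\<close>

definition A_elt :: "nat list \<Rightarrow> nat \<Rightarrow> nat \<Rightarrow> nat" where
  "A_elt \<beta> i j = glue \<beta> (top_pos \<beta> i - j)"

definition D_elt :: "nat list \<Rightarrow> nat \<Rightarrow> nat \<Rightarrow> nat" where
  "D_elt \<beta> i j = glue \<beta> (top_pos \<beta> i + j)"

text \<open>Closure under a relation carries over to its transitive closure, so the order can be
  tested within single segments.\<close>

lemma upper_ideals_iff_segments:
  "U \<in> upper_ideals \<beta> \<longleftrightarrow> U \<subseteq> circ_fence \<beta> \<and>
    (\<forall>k < length \<beta>. \<forall>x \<in> segment \<beta> k. \<forall>y \<in> segment \<beta> k.
      (if even k then x \<le> y else y \<le> x) \<longrightarrow> glue \<beta> x \<in> U \<longrightarrow> glue \<beta> y \<in> U)"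
  (is "_ \<longleftrightarrow> _ \<and> ?closed")
proof -
  let ?R = "map_prod (glue \<beta>) (glue \<beta>) ` chain_rel \<beta>"
  have step: "(glue \<beta> x, glue \<beta> y) \<in> ?R \<and> glue \<beta> y \<in> circ_fence \<beta>"
    if "k < length \<beta>" "x \<in> segment \<beta> k" "y \<in> segment \<beta> k" "if even k then x \<le> y else y \<le> x" for k x y
  proof -
    have "(x, y) \<in> chain_rel \<beta>" using that unfolding chain_rel_def by blast
    moreover have "sum_list (take (Suc k) \<beta>) \<le> sum_list \<beta>"
      by (metis append_take_drop_id le_add1 sum_list_append)
    ultimately have "y \<in> {0..sum_list \<beta>}" "(x, y) \<in> chain_rel \<beta>"
      using that(3) by (auto simp: segment_def)
    then show ?thesis
      unfolding circ_fence_def by (metis imageI map_prod_simp)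
  qed
  show ?thesis
  proof (intro iffI conjI)
    assume U: "U \<in> upper_ideals \<beta>"
    then show "U \<subseteq> circ_fence \<beta>" by (simp add: upper_ideals_def)
    show ?closed
    proof (intro allI impI ballI)
      fix k x y
      assume "k < length \<beta>" "x \<in> segment \<beta> k" "y \<in> segment \<beta> k" "if even k then x \<le> y else y \<le> x"
        and x: "glue \<beta> x \<in> U"
      from step[OF this(1-4)] have "circ_fence_le \<beta> (glue \<beta> x) (glue \<beta> y)" "glue \<beta> y \<in> circ_fence \<beta>"
        unfolding circ_fence_le_def by (simp_all add: r_into_trancl)
      then show "glue \<beta> y \<in> U"
        using U x by (simp add: upper_ideals_def)
    qed
  next
    assume U: "U \<subseteq> circ_fence \<beta> \<and> ?closed"
    have one: "y \<in> U" if "(x, y) \<in> ?R" "x \<in> U" for x y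
    proof -
      from that(1) obtain x' y' where "(x', y') \<in> chain_rel \<beta>" "x = glue \<beta> x'" "y = glue \<beta> y'"
        by (auto simp: map_prod_def)
      then obtain k where "k < length \<beta>" "x' \<in> segment \<beta> k" "y' \<in> segment \<beta> k"
          "if even k then x' \<le> y' else y' \<le> x'"
        unfolding chain_rel_def by blast
      from conjunct2[OF U, rule_format, OF this] show ?thesis
        using that(2) \<open>x = _\<close> \<open>y = _\<close> by simp
    qed
    have "y \<in> U" if "(x, y) \<in> ?R\<^sup>+" "x \<in> U" for x y
      using that by (induction rule: trancl_induct) (blast intro: one)+
    then show "U \<in> upper_ideals \<beta>"
      using U by (simp add: upper_ideals_def circ_fence_le_def)
  qed
qed

section \<open>Positions and the partition of the fence\<close>

context
  fixes \<beta> :: "nat list" and l :: nat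
  assumes comp: "composition \<beta>" and len: "length \<beta> = 2 * l" and l: "1 \<le> l"
begin

lemma half_eq: "half \<beta> = l"
  using len by simp

lemma sum_take_Suc: "k < 2 * l \<Longrightarrow> sum_list (take (Suc k) \<beta>) = sum_list (take k \<beta>) + \<beta> ! k"
  by (simp add: take_Suc_conv_app_nth len)

lemma sum_take_mono: "k \<le> k' \<Longrightarrow> sum_list (take k \<beta>) \<le> sum_list (take k' \<beta>)"
  by (metis le_add1 le_add_diff_inverse sum_list_append take_add)

lemma pos_entry: "k < 2 * l \<Longrightarrow> 0 < \<beta> ! k"
  using comp by (simp add: composition_def len)

lemma sum_take_top:
  assumes "i < l"
  shows "sum_list (take (2 * i) \<beta>) + alpha \<beta> i = top_pos \<beta> i"
    "sum_list (take (2 * i + 2) \<beta>) = top_pos \<beta> i + delta \<beta> i"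
    "top_pos \<beta> i + delta \<beta> i \<le> sum_list \<beta>" "0 < alpha \<beta> i" "0 < delta \<beta> i"
proof -
  show "sum_list (take (2 * i) \<beta>) + alpha \<beta> i = top_pos \<beta> i"
    using sum_take_Suc[of "2 * i"] assms by (simp add: top_pos_def alpha_def)
  show *: "sum_list (take (2 * i + 2) \<beta>) = top_pos \<beta> i + delta \<beta> i"
    using sum_take_Suc[of "2 * i + 1"] assms by (simp add: top_pos_def delta_def)
  show "top_pos \<beta> i + delta \<beta> i \<le> sum_list \<beta>"
    using sum_take_mono[of "2 * i + 2" "2 * l"] assms unfolding *[symmetric] by (simp add: len)
  show "0 < alpha \<beta> i" "0 < delta \<beta> i"
    using pos_entry assms by (simp_all add: alpha_def delta_def)
qed

lemma sum_pos: "0 < sum_list \<beta>"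
  using sum_take_top[of 0] l by simp

text \<open>The glued point is represented by \<open>sum_list \<beta>\<close> rather than by 0,
  which places it on the last descending segment, as the partition into \<open>A_tilde\<close> and
  \<open>D_seg\<close> demands.\<close>

lemma glue_inj: "inj_on (glue \<beta>) {1..sum_list \<beta>}"
proof (rule inj_onI)
  fix x y assume "x \<in> {1..sum_list \<beta>}" "y \<in> {1..sum_list \<beta>}" "glue \<beta> x = glue \<beta> y"
  then show "x = y"
    unfolding glue_def by (cases "x = sum_list \<beta>"; cases "y = sum_list \<beta>") auto
qed

lemma glue_0: "glue \<beta> 0 = glue \<beta> (sum_list \<beta>)"
  by (simp add: glue_def)

lemma circ_fence_eq: "circ_fence \<beta> = glue \<beta> ` {1..sum_list \<beta>}"
proof -
  have "{0..sum_list \<beta>} = insert 0 {1..sum_list \<beta>}" by auto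
  then show ?thesis
    unfolding circ_fence_def using glue_0 sum_pos by (auto simp: image_iff Suc_le_eq)
qed

definition A_pos :: "nat \<Rightarrow> nat set" where
  "A_pos i = {sum_list (take (2 * i) \<beta>)<..<top_pos \<beta> i}"

definition D_pos :: "nat \<Rightarrow> nat set" where
  "D_pos i = {top_pos \<beta> i..sum_list (take (2 * i + 2) \<beta>)}"

lemma pos_union: "m \<le> l \<Longrightarrow> (\<Union>i<m. A_pos i \<union> D_pos i) = {0<..sum_list (take (2 * m) \<beta>)}"
proof (induction m)
  case (Suc m)
  have "A_pos m \<union> D_pos m = {sum_list (take (2 * m) \<beta>)<..sum_list (take (2 * Suc m) \<beta>)}"
    using sum_take_top[of m] Suc.prems by (auto simp: A_pos_def D_pos_def)
  moreover have "sum_list (take (2 * m) \<beta>) \<le> sum_list (take (2 * Suc m) \<beta>)"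
    by (rule sum_take_mono) simp
  ultimately show ?case using Suc by (auto simp: lessThan_Suc)
qed simp

lemma pos_disjoint:
  assumes "i < l" "i' < l"
  shows "A_pos i \<inter> D_pos i' = {}" "i \<noteq> i' \<Longrightarrow> A_pos i \<inter> A_pos i' = {}"
    "i \<noteq> i' \<Longrightarrow> D_pos i \<inter> D_pos i' = {}"
proof -
  have in_block: "A_pos k \<union> D_pos k \<subseteq> {sum_list (take (2 * k) \<beta>)<..sum_list (take (2 * k + 2) \<beta>)}"
    if "k < l" for k
    using sum_take_top[OF that] by (auto simp: A_pos_def D_pos_def)
  have lt: "(A_pos k \<union> D_pos k) \<inter> (A_pos k' \<union> D_pos k') = {}" if "k < k'" "k < l" "k' < l" for k k'
    using in_block[OF that(2)] in_block[OF that(3)] sum_take_mono[of "2 * k + 2" "2 * k'"] that(1)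
    by fastforce
  have ne: "(A_pos i \<union> D_pos i) \<inter> (A_pos i' \<union> D_pos i') = {}" if "i \<noteq> i'"
    using lt[of i i'] lt[of i' i] assms that by (metis Int_commute linorder_neqE_nat)
  show "A_pos i \<inter> D_pos i' = {}"
    using ne by (cases "i = i'") (auto simp: A_pos_def D_pos_def)
  show "i \<noteq> i' \<Longrightarrow> A_pos i \<inter> A_pos i' = {}" "i \<noteq> i' \<Longrightarrow> D_pos i \<inter> D_pos i' = {}"
    using ne by blast+
qed

lemma pos_subset:
  assumes "i < l"
  shows "A_pos i \<subseteq> {1..sum_list \<beta>}" "D_pos i \<subseteq> {1..sum_list \<beta>}"
proof -
  have "A_pos i \<union> D_pos i \<subseteq> {0<..sum_list (take (2 * l) \<beta>)}"
    using pos_union[OF order_refl] assms by blast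
  then show "A_pos i \<subseteq> {1..sum_list \<beta>}" "D_pos i \<subseteq> {1..sum_list \<beta>}"
    by (auto simp: len Suc_le_eq)
qed

lemma D_seg_eq: "D_seg \<beta> i = glue \<beta> ` D_pos i"
  by (simp add: D_seg_def circ_segment_def segment_def D_pos_def top_pos_def)

lemma A_tilde_eq:
  assumes "i < l"
  shows "A_tilde \<beta> i = glue \<beta> ` A_pos i"
proof
  have seg: "segment \<beta> (2 * i) = {sum_list (take (2 * i) \<beta>)..top_pos \<beta> i}"
    by (simp add: segment_def top_pos_def)
  show "A_tilde \<beta> i \<subseteq> glue \<beta> ` A_pos i"
  proof
    fix z assume z: "z \<in> A_tilde \<beta> i"
    then obtain x where x: "x \<in> segment \<beta> (2 * i)" "z = glue \<beta> x"
      by (auto simp: A_tilde_def circ_segment_def)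
    have no: "z \<notin> circ_segment \<beta> k" if "k < 2 * l" "k \<noteq> 2 * i" for k
      using z that by (auto simp: A_tilde_def len)
    have "x \<noteq> top_pos \<beta> i"
      using no[of "2 * i + 1"] assms x sum_take_top[OF assms]
      by (auto simp: circ_segment_def segment_def top_pos_def)
    moreover have "x \<noteq> sum_list (take (2 * i) \<beta>)"
    proof
      assume e: "x = sum_list (take (2 * i) \<beta>)"
      show False
      proof (cases i)
        \<comment> \<open>The first ascending segment starts at position 0, which is glued to the
          end of the last descending one.\<close>
        case 0
        have "sum_list \<beta> \<in> segment \<beta> (2 * l - 1)"
          using sum_take_mono[of "2 * l - 1" "2 * l"] l by (simp add: segment_def len)
        then show False
          using no[of "2 * l - 1"] x(2) e 0 l glue_0 by (auto simp: circ_segment_def)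
      next
        case (Suc h)
        have "x \<in> segment \<beta> (2 * h + 1)"
          using e Suc sum_take_mono[of "2 * h + 1" "2 * h + 2"] by (simp add: segment_def)
        then show False
          using no[of "2 * h + 1"] x(2) Suc assms by (auto simp: circ_segment_def)
      qed
    qed
    ultimately show "z \<in> glue \<beta> ` A_pos i"
      using x seg by (auto simp: A_pos_def)
  qed
  show "glue \<beta> ` A_pos i \<subseteq> A_tilde \<beta> i"
  proof
    fix z assume "z \<in> glue \<beta> ` A_pos i"
    then obtain x where x: "x \<in> A_pos i" "z = glue \<beta> x" by blast
    have xr: "x \<in> {1..sum_list \<beta>}" "x < sum_list \<beta>"
      using pos_subset(1)[OF assms] x sum_take_top[OF assms] by (auto simp: A_pos_def)
    have "z \<notin> circ_segment \<beta> k" if k: "k < 2 * l" "k \<noteq> 2 * i" for k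
    proof
      assume "z \<in> circ_segment \<beta> k"
      then obtain y where y: "y \<in> segment \<beta> k" "glue \<beta> x = glue \<beta> y"
        using x by (auto simp: circ_segment_def)
      have "y \<le> sum_list \<beta>"
        using y(1) sum_take_mono[of "Suc k" "2 * l"] k by (auto simp: segment_def len)
      \<comment> \<open>Position 0 is outside the range of \<open>glue_inj\<close>. It stands for
        the same point as \<open>sum_list \<beta>\<close>, and \<open>x\<close> is strictly smaller
        than that.\<close>
      have "y \<noteq> 0"
      proof
        assume "y = 0"
        then have "glue \<beta> x = glue \<beta> (sum_list \<beta>)" using y(2) glue_0 by simp
        from inj_onD[OF glue_inj this] show False using xr by simp
      qed
      then have "x = y"
        using inj_onD[OF glue_inj y(2)] xr \<open>y \<le> _\<close> by auto
      then have "x \<in> segment \<beta> k" using y by simp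
      then show False
        using x(1) k(2) sum_take_mono[of "Suc k" "2 * i"] sum_take_mono[of "2 * i + 1" k]
        by (cases "k < 2 * i") (auto simp: segment_def A_pos_def top_pos_def)
    qed
    then show "z \<in> A_tilde \<beta> i"
      using x seg by (auto simp: A_tilde_def circ_segment_def A_pos_def len)
  qed
qed

lemma A_pos_conv: "i < l \<Longrightarrow> A_pos i = (\<lambda>j. top_pos \<beta> i - j) ` {1..<alpha \<beta> i}"
proof (intro equalityI subsetI)
  fix x assume i: "i < l" and x: "x \<in> A_pos i"
  then have "x = top_pos \<beta> i - (top_pos \<beta> i - x)" "top_pos \<beta> i - x \<in> {1..<alpha \<beta> i}"
    using sum_take_top(1)[OF i] by (auto simp: A_pos_def)
  then show "x \<in> (\<lambda>j. top_pos \<beta> i - j) ` {1..<alpha \<beta> i}" by blast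
qed (use sum_take_top(1)[of i] in \<open>auto simp: A_pos_def\<close>)

lemma D_pos_conv: "i < l \<Longrightarrow> D_pos i = (\<lambda>j. top_pos \<beta> i + j) ` {0..<delta \<beta> i + 1}"
  using sum_take_top(2)[of i] by (simp add: D_pos_def atLeastLessThanSuc_atLeastAtMost)

lemma A_tilde_image: "i < l \<Longrightarrow> A_tilde \<beta> i = A_elt \<beta> i ` {1..<alpha \<beta> i}"
  by (simp add: A_tilde_eq A_pos_conv image_image A_elt_def)

lemma D_seg_image: "i < l \<Longrightarrow> D_seg \<beta> i = D_elt \<beta> i ` {0..<delta \<beta> i + 1}"
  unfolding D_seg_eq D_pos_conv image_image D_elt_def ..

lemma A_elt_inj: "i < l \<Longrightarrow> inj_on (A_elt \<beta> i) {1..<alpha \<beta> i}"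
proof -
  assume i: "i < l"
  have "inj_on (\<lambda>j. top_pos \<beta> i - j) {1..<alpha \<beta> i}"
    using sum_take_top(1)[OF i] by (auto intro!: inj_onI)
  then have "inj_on (glue \<beta> \<circ> (\<lambda>j. top_pos \<beta> i - j)) {1..<alpha \<beta> i}"
    using inj_on_subset[OF glue_inj pos_subset(1)[OF i]] unfolding A_pos_conv[OF i]
    by (rule comp_inj_on)
  then show ?thesis by (simp add: comp_def A_elt_def[abs_def])
qed

lemma D_elt_inj: "i < l \<Longrightarrow> inj_on (D_elt \<beta> i) {0..<delta \<beta> i + 1}"
proof -
  assume i: "i < l"
  have "inj_on (\<lambda>j. top_pos \<beta> i + j) {0..<delta \<beta> i + 1}"
    by (auto intro!: inj_onI)
  then have "inj_on (glue \<beta> \<circ> (\<lambda>j. top_pos \<beta> i + j)) {0..<delta \<beta> i + 1}"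
    using inj_on_subset[OF glue_inj pos_subset(2)[OF i]] unfolding D_pos_conv[OF i]
    by (rule comp_inj_on)
  then show ?thesis by (simp add: comp_def D_elt_def[abs_def])
qed

lemma glue_disjoint:
  assumes "X \<subseteq> {1..sum_list \<beta>}" "Y \<subseteq> {1..sum_list \<beta>}" "X \<inter> Y = {}"
  shows "glue \<beta> ` X \<inter> glue \<beta> ` Y = {}"
  using inj_on_image_Int[OF glue_inj assms(1,2)] assms(3) by simp

lemma parts_disjoint:
  assumes "i < l" "i' < l"
  shows "A_tilde \<beta> i \<inter> D_seg \<beta> i' = {}" "i \<noteq> i' \<Longrightarrow> A_tilde \<beta> i \<inter> A_tilde \<beta> i' = {}"
    "i \<noteq> i' \<Longrightarrow> D_seg \<beta> i \<inter> D_seg \<beta> i' = {}"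
  unfolding A_tilde_eq[OF assms(1)] A_tilde_eq[OF assms(2)] D_seg_eq
  by (rule glue_disjoint; intro pos_subset pos_disjoint assms; assumption?)+

lemma circ_fence_parts: "circ_fence \<beta> = (\<Union>i<l. A_tilde \<beta> i \<union> D_seg \<beta> i)"
proof -
  have "{1..sum_list \<beta>} = (\<Union>i<l. A_pos i \<union> D_pos i)"
    using pos_union[OF order_refl] by (simp add: len) auto
  then have "circ_fence \<beta> = (\<Union>i<l. glue \<beta> ` A_pos i \<union> glue \<beta> ` D_pos i)"
    unfolding circ_fence_eq by (simp only: image_UN image_Un)
  also have "\<dots> = (\<Union>i<l. A_tilde \<beta> i \<union> D_seg \<beta> i)"
    by (simp add: A_tilde_eq D_seg_eq)
  finally show ?thesis .
qed

section \<open>Filters as initial ranges of distances from the maximal elements\<close>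

lemma A_elt_0: "A_elt \<beta> i 0 = D_elt \<beta> i 0"
  by (simp add: A_elt_def D_elt_def)

text \<open>Each ascending chain starts where the previous descending one ends; for the last
  \<open>i\<close>, this is the gluing of 0 and \<open>sum_list \<beta>\<close>.\<close>

lemma A_elt_alpha:
  assumes "i < l"
  shows "A_elt \<beta> (cyc_suc l i) (alpha \<beta> (cyc_suc l i)) = D_elt \<beta> i (delta \<beta> i)"
proof (cases "i + 1 < l")
  case True
  then show ?thesis
    using sum_take_top(1)[of "i + 1"] sum_take_top(2)[OF assms]
    by (simp add: A_elt_def D_elt_def cyc_suc_def) (metis add_diff_cancel_right')
next
  case False
  then have "i + 1 = l" using assms by simp
  then have "2 * i + 2 = 2 * l" by simp
  then have "top_pos \<beta> i + delta \<beta> i = sum_list \<beta>"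
    using sum_take_top(2)[OF assms] by (simp add: len)
  moreover have "top_pos \<beta> 0 = alpha \<beta> 0" using sum_take_top(1)[of 0] l by simp
  ultimately show ?thesis
    using glue_0 \<open>i + 1 = l\<close> by (simp add: A_elt_def D_elt_def cyc_suc_def)
qed

text \<open>In both kinds of segment, going up means coming closer to the maximal element. Both end
  points are included, so neighbouring segments are linked through their common elements.\<close>

lemma upper_ideals_iff:
  "U \<in> upper_ideals \<beta> \<longleftrightarrow> U \<subseteq> circ_fence \<beta> \<and>
    (\<forall>i<l. (\<forall>j\<le>alpha \<beta> i. A_elt \<beta> i j \<in> U \<longrightarrow> (\<forall>k\<le>j. A_elt \<beta> i k \<in> U)) \<and>
      (\<forall>j\<le>delta \<beta> i. D_elt \<beta> i j \<in> U \<longrightarrow> (\<forall>k\<le>j. D_elt \<beta> i k \<in> U)))"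
proof -
  have all2: "(\<forall>k < length \<beta>. P k) \<longleftrightarrow> (\<forall>i<l. P (2 * i) \<and> P (2 * i + 1))" for P
  proof
    assume r: "\<forall>i<l. P (2 * i) \<and> P (2 * i + 1)"
    show "\<forall>k < length \<beta>. P k"
    proof (intro allI impI)
      fix k assume "k < length \<beta>"
      then have "k div 2 < l" by (simp add: len)
      then show "P k" using r by (cases "even k") (metis dvd_mult_div_cancel, metis odd_two_times_div_two_succ)
    qed
  qed (simp add: len)
  have A: "(\<forall>x \<in> segment \<beta> (2 * i). \<forall>y \<in> segment \<beta> (2 * i). x \<le> y \<longrightarrow> glue \<beta> x \<in> U \<longrightarrow> glue \<beta> y \<in> U)
    \<longleftrightarrow> (\<forall>j\<le>alpha \<beta> i. A_elt \<beta> i j \<in> U \<longrightarrow> (\<forall>k\<le>j. A_elt \<beta> i k \<in> U))" if "i < l" for i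
  proof -
    have "segment \<beta> (2 * i) = (\<lambda>j. top_pos \<beta> i - j) ` {..alpha \<beta> i}"
    proof (intro equalityI subsetI)
      fix x assume "x \<in> segment \<beta> (2 * i)"
      then have "x = top_pos \<beta> i - (top_pos \<beta> i - x)" "top_pos \<beta> i - x \<le> alpha \<beta> i"
        using sum_take_top(1)[OF that] by (auto simp: segment_def top_pos_def)
      then show "x \<in> (\<lambda>j. top_pos \<beta> i - j) ` {..alpha \<beta> i}" by blast
    qed (use sum_take_top(1)[OF that] in \<open>auto simp: segment_def top_pos_def\<close>)
    moreover have "top_pos \<beta> i - j \<le> top_pos \<beta> i - k \<longleftrightarrow> k \<le> j"
      if "j \<le> alpha \<beta> i" "k \<le> alpha \<beta> i" for j k
      using that sum_take_top(1)[OF \<open>i < l\<close>] by auto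
    ultimately show ?thesis unfolding A_elt_def by auto
  qed
  have D: "(\<forall>x \<in> segment \<beta> (2 * i + 1). \<forall>y \<in> segment \<beta> (2 * i + 1). y \<le> x \<longrightarrow> glue \<beta> x \<in> U \<longrightarrow> glue \<beta> y \<in> U)
    \<longleftrightarrow> (\<forall>j\<le>delta \<beta> i. D_elt \<beta> i j \<in> U \<longrightarrow> (\<forall>k\<le>j. D_elt \<beta> i k \<in> U))" if "i < l" for i
  proof -
    have "segment \<beta> (2 * i + 1) = (\<lambda>j. top_pos \<beta> i + j) ` {..delta \<beta> i}"
      using sum_take_top(2)[OF that] by (simp add: segment_def top_pos_def atMost_atLeast0)
    then show ?thesis unfolding D_elt_def by auto
  qed
  show ?thesis
    unfolding upper_ideals_iff_segments all2 using A D by simp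
qed

text \<open>On \<open>A_tilde\<close> the distances start at 1, since the maximal element is counted
  in \<open>D_seg\<close>; hence \<open>\<le>\<close> in one case and \<open><\<close> in the
  other.\<close>

lemma upper_ideal_mem:
  assumes U: "U \<in> upper_ideals \<beta>" and i: "i < l"
  shows "0 < j \<Longrightarrow> j < alpha \<beta> i \<Longrightarrow> A_elt \<beta> i j \<in> U \<longleftrightarrow> j \<le> card (U \<inter> A_tilde \<beta> i)"
    "j \<le> delta \<beta> i \<Longrightarrow> D_elt \<beta> i j \<in> U \<longleftrightarrow> j < card (U \<inter> D_seg \<beta> i)"
proof -
  define S where "S = {j \<in> {1..<alpha \<beta> i}. A_elt \<beta> i j \<in> U}"
  have A: "\<And>j k. j \<le> alpha \<beta> i \<Longrightarrow> A_elt \<beta> i j \<in> U \<Longrightarrow> k \<le> j \<Longrightarrow> A_elt \<beta> i k \<in> U"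
    and D: "\<And>j k. j \<le> delta \<beta> i \<Longrightarrow> D_elt \<beta> i j \<in> U \<Longrightarrow> k \<le> j \<Longrightarrow> D_elt \<beta> i k \<in> U"
    using U i unfolding upper_ideals_iff by blast+
  have "U \<inter> A_tilde \<beta> i = A_elt \<beta> i ` S"
    unfolding A_tilde_image[OF i] S_def by auto
  moreover have "inj_on (A_elt \<beta> i) S"
    by (rule inj_on_subset[OF A_elt_inj[OF i]]) (auto simp: S_def)
  ultimately have card: "card (U \<inter> A_tilde \<beta> i) = card S"
    by (simp add: card_image)
  have "S = {1..<1 + card S}"
    by (rule initial_segment_card) (auto simp: S_def intro: A[OF less_imp_le])
  then have "j \<in> S \<longleftrightarrow> 1 \<le> j \<and> j < 1 + card S" by (metis atLeastLessThan_iff)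
  then show "A_elt \<beta> i j \<in> U \<longleftrightarrow> j \<le> card (U \<inter> A_tilde \<beta> i)" if "0 < j" "j < alpha \<beta> i"
    using that unfolding card by (auto simp: S_def)
  define S' where "S' = {j \<in> {0..<delta \<beta> i + 1}. D_elt \<beta> i j \<in> U}"
  have "U \<inter> D_seg \<beta> i = D_elt \<beta> i ` S'"
    unfolding D_seg_image[OF i] S'_def by auto
  moreover have "inj_on (D_elt \<beta> i) S'"
    by (rule inj_on_subset[OF D_elt_inj[OF i]]) (auto simp: S'_def)
  ultimately have card': "card (U \<inter> D_seg \<beta> i) = card S'"
    by (simp add: card_image)
  have "S' = {0..<0 + card S'}"
    by (rule initial_segment_card) (auto simp: S'_def less_Suc_eq_le intro: D)
  then have "j \<in> S' \<longleftrightarrow> 0 \<le> j \<and> j < 0 + card S'" by (metis atLeastLessThan_iff)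
  then show "D_elt \<beta> i j \<in> U \<longleftrightarrow> j < card (U \<inter> D_seg \<beta> i)" if "j \<le> delta \<beta> i"
    using that unfolding card' by (auto simp: S'_def)
qed

lemma finite_parts: "i < l \<Longrightarrow> finite (A_tilde \<beta> i)" "i < l \<Longrightarrow> finite (D_seg \<beta> i)"
  by (simp_all add: A_tilde_image D_seg_image)

lemma card_parts:
  "i < l \<Longrightarrow> card (A_tilde \<beta> i) = alpha \<beta> i - 1" "i < l \<Longrightarrow> card (D_seg \<beta> i) = delta \<beta> i + 1"
  using card_image[OF A_elt_inj, of i] card_image[OF D_elt_inj, of i]
  by (simp_all add: A_tilde_image D_seg_image)

lemma parts_subset: "i < l \<Longrightarrow> A_tilde \<beta> i \<subseteq> circ_fence \<beta>" "i < l \<Longrightarrow> D_seg \<beta> i \<subseteq> circ_fence \<beta>"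
  unfolding circ_fence_parts by blast+

lemma upper_ideal_unique:
  assumes "U \<in> upper_ideals \<beta>" "V \<in> upper_ideals \<beta>" "code_eq \<beta> (encode \<beta> U) (encode \<beta> V)"
  shows "U = V"
proof -
  have "x \<in> U \<longleftrightarrow> x \<in> V" if x: "x \<in> circ_fence \<beta>" for x
  proof -
    from x obtain i where i: "i < l" "x \<in> A_tilde \<beta> i \<or> x \<in> D_seg \<beta> i"
      unfolding circ_fence_parts by blast
    have c: "card (U \<inter> A_tilde \<beta> i) = card (V \<inter> A_tilde \<beta> i)"
      "card (U \<inter> D_seg \<beta> i) = card (V \<inter> D_seg \<beta> i)"
      using assms(3) i(1) unfolding code_eq_def encode_def half_eq by simp_all
    from i(2) show ?thesis
    proof
      assume "x \<in> A_tilde \<beta> i"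
      then obtain j where j: "x = A_elt \<beta> i j" "0 < j" "j < alpha \<beta> i"
        unfolding A_tilde_image[OF i(1)] by auto
      show ?thesis
        unfolding j(1) upper_ideal_mem(1)[OF assms(1) i(1) j(2,3)]
          upper_ideal_mem(1)[OF assms(2) i(1) j(2,3)] c ..
    next
      assume "x \<in> D_seg \<beta> i"
      then obtain j where j: "x = D_elt \<beta> i j" "j \<le> delta \<beta> i"
        unfolding D_seg_image[OF i(1)] by auto
      show ?thesis
        unfolding j(1) upper_ideal_mem(2)[OF assms(1) i(1) j(2)]
          upper_ideal_mem(2)[OF assms(2) i(1) j(2)] c ..
    qed
  qed
  moreover have "U \<subseteq> circ_fence \<beta>" "V \<subseteq> circ_fence \<beta>"
    using assms unfolding upper_ideals_def by blast+
  ultimately show ?thesis by blast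
qed

lemma card_part_le:
  assumes "i < l"
  shows "card (X \<inter> A_tilde \<beta> i) \<le> alpha \<beta> i - 1" "card (X \<inter> D_seg \<beta> i) \<le> delta \<beta> i + 1"
  using card_mono[OF finite_parts(1)[OF assms], of "X \<inter> A_tilde \<beta> i"]
    card_mono[OF finite_parts(2)[OF assms], of "X \<inter> D_seg \<beta> i"] card_parts[OF assms] by simp_all

lemma upper_code_encode:
  assumes U: "U \<in> upper_ideals \<beta>"
  shows "upper_code \<beta> (encode \<beta> U)"
proof -
  let ?b = "\<lambda>i. card (U \<inter> A_tilde \<beta> i)" and ?e = "\<lambda>i. card (U \<inter> D_seg \<beta> i)"
  have "(0 < ?b i \<longrightarrow> 0 < ?e i) \<and>
      (?e i = delta \<beta> i + 1 \<longrightarrow> ?b j = alpha \<beta> j - 1 \<and> 0 < ?e j)"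
    if i: "i < l" and j_def: "j = cyc_suc l i" for i j
  proof (intro conjI impI)
    have j: "j < l" using i j_def by (simp add: cyc_suc_less)
    have A: "\<And>i m k. i < l \<Longrightarrow> m \<le> alpha \<beta> i \<Longrightarrow> A_elt \<beta> i m \<in> U \<Longrightarrow> k \<le> m \<Longrightarrow> A_elt \<beta> i k \<in> U"
      using U unfolding upper_ideals_iff by blast
    have e_pos: "0 < ?e k" if "A_elt \<beta> k 0 \<in> U" "k < l" for k
      using that upper_ideal_mem(2)[OF U that(2), of 0] by (simp add: A_elt_0)
    show "0 < ?e i" if "0 < ?b i"
    proof -
      have "1 < alpha \<beta> i" using that card_part_le(1)[OF i, of U] by simp
      then have "A_elt \<beta> i 1 \<in> U"
        using upper_ideal_mem(1)[OF U i, of 1] that by simp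
      with A[OF i, of 1 0] \<open>1 < _\<close> show ?thesis by (intro e_pos i) simp
    qed
    assume "?e i = delta \<beta> i + 1"
    then have "D_elt \<beta> i (delta \<beta> i) \<in> U"
      using upper_ideal_mem(2)[OF U i order_refl] by simp
    then have top: "A_elt \<beta> j (alpha \<beta> j) \<in> U"
      unfolding j_def A_elt_alpha[OF i] .
    show "0 < ?e j" using A[OF j order_refl top, of 0] by (intro e_pos j) simp
    show "?b j = alpha \<beta> j - 1"
    \<comment> \<open>If the interior of the chain is empty, distance
      \<open>alpha \<beta> j - 1\<close> is 0, the maximal element, which is not in
      \<open>A_tilde\<close>.\<close>
    proof (cases "alpha \<beta> j - 1 = 0")
      case True
      then show ?thesis using card_part_le(1)[OF j, of U] by linarith
    next
      case False
      then have "alpha \<beta> j - 1 \<le> ?b j"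
        using A[OF j order_refl top, of "alpha \<beta> j - 1"] upper_ideal_mem(1)[OF U j, of "alpha \<beta> j - 1"]
        by simp
      then show ?thesis using card_part_le(1)[OF j, of U] by linarith
    qed
  qed
  then show ?thesis
    unfolding upper_code_def encode_def half_eq using card_part_le[of _ U] by (simp add: Let_def)
qed

text \<open>The values prescribe initial ranges of distances. The implications in
  \<open>upper_code\<close> yield closure along ascending chains, whose two ends lie on descending
  segments and are governed by \<open>e\<close>.\<close>

lemma upper_ideal_exists:
  assumes "upper_code \<beta> (b, e)"
  shows "\<exists>U \<in> upper_ideals \<beta>. encoded_by \<beta> U (b, e)"
proof -
  define U where "U = (\<Union>i<l. A_elt \<beta> i ` {1..<b i + 1} \<union> D_elt \<beta> i ` {0..<e i})"
  have code: "b i \<le> alpha \<beta> i - 1" "e i \<le> delta \<beta> i + 1" "0 < b i \<Longrightarrow> 0 < e i"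
      "e i = delta \<beta> i + 1 \<Longrightarrow> b (cyc_suc l i) = alpha \<beta> (cyc_suc l i) - 1 \<and> 0 < e (cyc_suc l i)"
    if "i < l" for i
    using assms that unfolding upper_code_def half_eq by (auto simp: Let_def)
  have sub: "{1..<b i + 1} \<subseteq> {1..<alpha \<beta> i}" "{0..<e i} \<subseteq> {0..<delta \<beta> i + 1}" if "i < l" for i
    using code(1,2)[OF that] sum_take_top(4)[OF that] by auto
  have part: "A_elt \<beta> i ` {1..<b i + 1} \<subseteq> A_tilde \<beta> i" "D_elt \<beta> i ` {0..<e i} \<subseteq> D_seg \<beta> i"
    if "i < l" for i
    unfolding A_tilde_image[OF that] D_seg_image[OF that] using sub[OF that] by (simp_all add: image_mono)
  have UA: "U \<inter> A_tilde \<beta> i = A_elt \<beta> i ` {1..<b i + 1}" if i: "i < l" for i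
  proof
    show "U \<inter> A_tilde \<beta> i \<subseteq> A_elt \<beta> i ` {1..<b i + 1}"
    proof
      fix x assume x: "x \<in> U \<inter> A_tilde \<beta> i"
      then obtain k where k: "k < l" "x \<in> A_elt \<beta> k ` {1..<b k + 1} \<or> x \<in> D_elt \<beta> k ` {0..<e k}"
        unfolding U_def by blast
      have "x \<notin> D_elt \<beta> k ` {0..<e k}"
        using part(2)[OF k(1)] parts_disjoint(1)[OF i k(1)] x by blast
      with k have "x \<in> A_elt \<beta> k ` {1..<b k + 1}" by blast
      moreover from this have "k = i"
        using part(1)[OF k(1)] parts_disjoint(2)[OF i k(1)] x by blast
      ultimately show "x \<in> A_elt \<beta> i ` {1..<b i + 1}" by simp
    qed
  qed (use part(1)[OF i] i in \<open>auto simp: U_def\<close>)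
  have UD: "U \<inter> D_seg \<beta> i = D_elt \<beta> i ` {0..<e i}" if i: "i < l" for i
  proof
    show "U \<inter> D_seg \<beta> i \<subseteq> D_elt \<beta> i ` {0..<e i}"
    proof
      fix x assume x: "x \<in> U \<inter> D_seg \<beta> i"
      then obtain k where k: "k < l" "x \<in> A_elt \<beta> k ` {1..<b k + 1} \<or> x \<in> D_elt \<beta> k ` {0..<e k}"
        unfolding U_def by blast
      have "x \<notin> A_elt \<beta> k ` {1..<b k + 1}"
        using part(1)[OF k(1)] parts_disjoint(1)[OF k(1) i] x by blast
      with k have "x \<in> D_elt \<beta> k ` {0..<e k}" by blast
      moreover from this have "k = i"
        using part(2)[OF k(1)] parts_disjoint(3)[OF i k(1)] x by blast
      ultimately show "x \<in> D_elt \<beta> i ` {0..<e i}" by simp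
    qed
  qed (use part(2)[OF i] i in \<open>auto simp: U_def\<close>)
  have memA: "A_elt \<beta> i j \<in> U \<longleftrightarrow> j \<le> b i" if i: "i < l" and j: "0 < j" "j < alpha \<beta> i" for i j
  proof -
    have "A_elt \<beta> i j \<in> A_tilde \<beta> i" unfolding A_tilde_image[OF i] using j by auto
    then have "A_elt \<beta> i j \<in> U \<longleftrightarrow> A_elt \<beta> i j \<in> A_elt \<beta> i ` {1..<b i + 1}"
      using UA[OF i] by blast
    also have "\<dots> \<longleftrightarrow> j \<in> {1..<b i + 1}"
      by (rule inj_on_image_mem_iff[OF A_elt_inj[OF i] _ sub(1)[OF i]]) (use j in auto)
    finally show ?thesis using j by auto
  qed
  have memD: "D_elt \<beta> i j \<in> U \<longleftrightarrow> j < e i" if i: "i < l" and j: "j \<le> delta \<beta> i" for i j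
  proof -
    have "D_elt \<beta> i j \<in> D_seg \<beta> i" unfolding D_seg_image[OF i] using j by auto
    then have "D_elt \<beta> i j \<in> U \<longleftrightarrow> D_elt \<beta> i j \<in> D_elt \<beta> i ` {0..<e i}"
      using UD[OF i] by blast
    also have "\<dots> \<longleftrightarrow> j \<in> {0..<e i}"
      by (rule inj_on_image_mem_iff[OF D_elt_inj[OF i] _ sub(2)[OF i]]) (use j in auto)
    finally show ?thesis by auto
  qed
  have "A_elt \<beta> i k \<in> U" if i: "i < l" and j: "j \<le> alpha \<beta> i" "A_elt \<beta> i j \<in> U" "k \<le> j" for i j k
  proof (cases "k = j")
    case False
    with j have k: "k < j" by simp
    \<comment> \<open>The first part settles \<open>k > 0\<close>; the second settles
      \<open>k = 0\<close>, the maximal element, which \<open>e i\<close> counts.\<close>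
    have "k \<le> b i \<and> 0 < e i"
    proof (cases "j = alpha \<beta> i")
      \<comment> \<open>Distance \<open>alpha \<beta> i\<close> is the bottom of the chain, the last
        element of the previous descending segment, which is therefore full.\<close>
      case True
      obtain h where h: "h < l" "i = cyc_suc l h" using i by (rule cyc_suc_surj)
      have "D_elt \<beta> h (delta \<beta> h) \<in> U"
        using j(2) True A_elt_alpha[OF h(1)] h(2) by simp
      then have "e h = delta \<beta> h + 1"
        using memD[OF h(1) order_refl] code(2)[OF h(1)] by simp
      then show ?thesis using code(4)[OF h(1)] h(2) k True by simp
    next
      case False
      then have "j \<le> b i" using memA[OF i, of j] j k by simp
      then show ?thesis using code(3)[OF i] k by simp
    qed
    then show ?thesis
      using memA[OF i, of k] memD[OF i, of 0] k j(1) by (cases "k = 0") (simp_all add: A_elt_0)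
  qed (use j in simp)
  moreover have "D_elt \<beta> i k \<in> U" if "i < l" "j \<le> delta \<beta> i" "D_elt \<beta> i j \<in> U" "k \<le> j" for i j k
    using memD[OF that(1), of j] memD[OF that(1), of k] that by simp
  moreover have "U \<subseteq> circ_fence \<beta>"
    unfolding U_def
    by (intro UN_least Un_least order_trans[OF part(1) parts_subset(1)]
        order_trans[OF part(2) parts_subset(2)]) simp_all
  ultimately have "U \<in> upper_ideals \<beta>"
    unfolding upper_ideals_iff by blast
  moreover have "card (U \<inter> A_tilde \<beta> i) = b i" "card (U \<inter> D_seg \<beta> i) = e i" if "i < l" for i
    using UA[OF that] UD[OF that] card_image[OF inj_on_subset[OF A_elt_inj[OF that] sub(1)[OF that]]]
      card_image[OF inj_on_subset[OF D_elt_inj[OF that] sub(2)[OF that]]] by simp_all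
  ultimately show ?thesis
    unfolding encoded_by_def half_eq by auto
qed

section \<open>Ideals as complements of filters\<close>

lemma lower_iff_upper_compl:
  assumes "I \<subseteq> circ_fence \<beta>"
  shows "I \<in> lower_ideals \<beta> \<longleftrightarrow> circ_fence \<beta> - I \<in> upper_ideals \<beta>"
  using assms unfolding lower_ideals_def upper_ideals_def by blast

lemma encode_compl:
  assumes "i < l" "I \<subseteq> circ_fence \<beta>"
  shows "card (I \<inter> A_tilde \<beta> i) + card ((circ_fence \<beta> - I) \<inter> A_tilde \<beta> i) = alpha \<beta> i - 1"
    "card (I \<inter> D_seg \<beta> i) + card ((circ_fence \<beta> - I) \<inter> D_seg \<beta> i) = delta \<beta> i + 1"
proof -
  have *: "card (I \<inter> X) + card ((circ_fence \<beta> - I) \<inter> X) = card X"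
    if "finite X" "X \<subseteq> circ_fence \<beta>" for X
  proof -
    have "X = (I \<inter> X) \<union> ((circ_fence \<beta> - I) \<inter> X)" using that by blast
    moreover have "card \<dots> = card (I \<inter> X) + card ((circ_fence \<beta> - I) \<inter> X)"
      using that by (intro card_Un_disjoint) auto
    ultimately show ?thesis by simp
  qed
  show "card (I \<inter> A_tilde \<beta> i) + card ((circ_fence \<beta> - I) \<inter> A_tilde \<beta> i) = alpha \<beta> i - 1"
    "card (I \<inter> D_seg \<beta> i) + card ((circ_fence \<beta> - I) \<inter> D_seg \<beta> i) = delta \<beta> i + 1"
    using *[OF finite_parts(1) parts_subset(1)] *[OF finite_parts(2) parts_subset(2)]
      card_parts assms(1) by simp_all
qed

text \<open>\<open>d i = 0\<close> says that the complement fills \<open>D_seg \<beta> i\<close>, so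
  the conditions are contrapositives of those on the complementary filter, taken at \<open>i\<close>
  and at \<open>j\<close>.\<close>

lemma lower_code_encode:
  assumes "I \<in> lower_ideals \<beta>"
  shows "lower_code \<beta> (encode \<beta> I)"
proof -
  let ?U = "circ_fence \<beta> - I"
  have sub: "I \<subseteq> circ_fence \<beta>" using assms by (simp add: lower_ideals_def)
  have "upper_code \<beta> (encode \<beta> ?U)"
    using assms lower_iff_upper_compl[OF sub] upper_code_encode by simp
  then have u: "0 < card (?U \<inter> A_tilde \<beta> i) \<longrightarrow> 0 < card (?U \<inter> D_seg \<beta> i)"
    "card (?U \<inter> D_seg \<beta> i) = delta \<beta> i + 1 \<longrightarrow>
      card (?U \<inter> A_tilde \<beta> (cyc_suc l i)) = alpha \<beta> (cyc_suc l i) - 1 \<and>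
      0 < card (?U \<inter> D_seg \<beta> (cyc_suc l i))" if "i < l" for i
    using that unfolding upper_code_def encode_def half_eq by (auto simp: Let_def)
  have "card (I \<inter> A_tilde \<beta> j) \<le> alpha \<beta> j - 1 \<and> card (I \<inter> D_seg \<beta> i) \<le> delta \<beta> i + 1 \<and>
      (0 < card (I \<inter> A_tilde \<beta> j) \<longrightarrow> 0 < card (I \<inter> D_seg \<beta> i)) \<and>
      (card (I \<inter> D_seg \<beta> j) = delta \<beta> j + 1 \<longrightarrow>
        card (I \<inter> A_tilde \<beta> j) = alpha \<beta> j - 1 \<and> 0 < card (I \<inter> D_seg \<beta> i))"
    if i: "i < l" and j_def: "j = cyc_suc l i" for i j
  proof -
    have j: "j < l" using i j_def by (simp add: cyc_suc_less)
    show ?thesis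
      using encode_compl[OF i sub] encode_compl[OF j sub] u(1)[OF j] u(2)[OF i, folded j_def]
      by linarith
  qed
  then show ?thesis
    unfolding lower_code_def encode_def half_eq by (simp add: Let_def)
qed

lemma lower_ideal_unique:
  assumes "I \<in> lower_ideals \<beta>" "J \<in> lower_ideals \<beta>" "code_eq \<beta> (encode \<beta> I) (encode \<beta> J)"
  shows "I = J"
proof -
  have sub: "I \<subseteq> circ_fence \<beta>" "J \<subseteq> circ_fence \<beta>" using assms by (simp_all add: lower_ideals_def)
  have "code_eq \<beta> (encode \<beta> (circ_fence \<beta> - I)) (encode \<beta> (circ_fence \<beta> - J))"
    unfolding code_eq_def half_eq
  proof (intro allI impI)
    fix i assume i: "i < l"
    have "card (I \<inter> A_tilde \<beta> i) = card (J \<inter> A_tilde \<beta> i)" "card (I \<inter> D_seg \<beta> i) = card (J \<inter> D_seg \<beta> i)"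
      using assms(3) i unfolding code_eq_def half_eq encode_def by simp_all
    with encode_compl[OF i sub(1)] encode_compl[OF i sub(2)]
    show "fst (encode \<beta> (circ_fence \<beta> - I)) i = fst (encode \<beta> (circ_fence \<beta> - J)) i \<and>
        snd (encode \<beta> (circ_fence \<beta> - I)) i = snd (encode \<beta> (circ_fence \<beta> - J)) i"
      by (simp add: encode_def)
  qed
  then have "circ_fence \<beta> - I = circ_fence \<beta> - J"
    using upper_ideal_unique assms lower_iff_upper_compl sub by blast
  then show ?thesis using sub by blast
qed

lemma code_size_encode:
  assumes "X \<subseteq> circ_fence \<beta>"
  shows "code_size \<beta> (encode \<beta> X) = card X"
proof -
  have fin: "finite (A_tilde \<beta> i \<union> D_seg \<beta> i)" if "i < l" for i using finite_parts that by simp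
  have "X = (\<Union>i<l. X \<inter> (A_tilde \<beta> i \<union> D_seg \<beta> i))"
    using assms unfolding circ_fence_parts by blast
  then have "card X = card (\<Union>i<l. X \<inter> (A_tilde \<beta> i \<union> D_seg \<beta> i))" by simp
  also have "\<dots> = (\<Sum>i<l. card (X \<inter> (A_tilde \<beta> i \<union> D_seg \<beta> i)))"
  proof (rule card_UN_disjoint)
    show "\<forall>i\<in>{..<l}. \<forall>j\<in>{..<l}. i \<noteq> j \<longrightarrow>
        X \<inter> (A_tilde \<beta> i \<union> D_seg \<beta> i) \<inter> (X \<inter> (A_tilde \<beta> j \<union> D_seg \<beta> j)) = {}"
    proof (intro ballI impI)
      fix i j assume "i \<in> {..<l}" "j \<in> {..<l}" "i \<noteq> j"
      then have "i < l" "j < l" by simp_all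
      from parts_disjoint[OF this] parts_disjoint(1)[OF this(2,1)] \<open>i \<noteq> j\<close>
      show "X \<inter> (A_tilde \<beta> i \<union> D_seg \<beta> i) \<inter> (X \<inter> (A_tilde \<beta> j \<union> D_seg \<beta> j)) = {}" by blast
    qed
  qed (use fin in auto)
  also have "\<dots> = (\<Sum>i<l. card (X \<inter> A_tilde \<beta> i) + card (X \<inter> D_seg \<beta> i))"
  proof (rule sum.cong[OF refl])
    fix i assume "i \<in> {..<l}"
    then have i: "i < l" by simp
    show "card (X \<inter> (A_tilde \<beta> i \<union> D_seg \<beta> i)) = card (X \<inter> A_tilde \<beta> i) + card (X \<inter> D_seg \<beta> i)"
      unfolding Int_Un_distrib using finite_parts[OF i] parts_disjoint(1)[OF i i]
      by (intro card_Un_disjoint) auto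
  qed
  finally show ?thesis by (simp add: code_size_def encode_def half_eq)
qed

section \<open>The bijection\<close>

lemma encoded_by_iff: "encoded_by \<beta> X c \<longleftrightarrow> code_eq \<beta> (encode \<beta> X) c"
  by (cases c) (simp add: encoded_by_def code_eq_def encode_def)

lemma card_lower_ideals: "card (lower_ideals \<beta>) = card (upper_ideals \<beta>)"
proof (rule bij_betw_same_card)
  show "bij_betw (\<lambda>I. circ_fence \<beta> - I) (lower_ideals \<beta>) (upper_ideals \<beta>)"
  proof (rule bij_betw_byWitness[of _ "\<lambda>U. circ_fence \<beta> - U"])
    show "\<forall>I\<in>lower_ideals \<beta>. circ_fence \<beta> - (circ_fence \<beta> - I) = I"
      "\<forall>U\<in>upper_ideals \<beta>. circ_fence \<beta> - (circ_fence \<beta> - U) = U"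
      by (auto simp: lower_ideals_def upper_ideals_def)
    show "(\<lambda>I. circ_fence \<beta> - I) ` lower_ideals \<beta> \<subseteq> upper_ideals \<beta>"
      using lower_iff_upper_compl by (auto simp: lower_ideals_def)
    show "(\<lambda>U. circ_fence \<beta> - U) ` upper_ideals \<beta> \<subseteq> lower_ideals \<beta>"
      by (auto simp: lower_ideals_def upper_ideals_def)
  qed
qed

lemma finite_upper_ideals: "finite (upper_ideals \<beta>)"
proof (rule finite_subset)
  show "upper_ideals \<beta> \<subseteq> Pow (circ_fence \<beta>)" by (auto simp: upper_ideals_def)
  show "finite (Pow (circ_fence \<beta>))" by (simp add: circ_fence_def)
qed

lemma Phi_circ_ex1:
  assumes "I \<in> lower_ideals \<beta>"
  shows "\<exists>!U. U \<in> upper_ideals \<beta> \<and> encoded_by \<beta> U (PHC \<beta> (encode \<beta> I))"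
proof -
  have "upper_code \<beta> (PHC \<beta> (encode \<beta> I))"
    by (rule PHC_upper_code[OF comp lower_code_encode[OF assms]])
  then obtain U where U: "U \<in> upper_ideals \<beta>" "encoded_by \<beta> U (PHC \<beta> (encode \<beta> I))"
    using upper_ideal_exists by (metis surj_pair)
  have "V = U" if "V \<in> upper_ideals \<beta>" "encoded_by \<beta> V (PHC \<beta> (encode \<beta> I))" for V
    using upper_ideal_unique[OF that(1) U(1)] that(2) U(2) by (simp add: encoded_by_iff code_eq_def)
  with U show ?thesis by blast
qed

lemma Phi_circ:
  assumes "I \<in> lower_ideals \<beta>"
  shows "Phi_circ \<beta> I \<in> upper_ideals \<beta>"
    "code_eq \<beta> (encode \<beta> (Phi_circ \<beta> I)) (PHC \<beta> (encode \<beta> I))"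
  using theI'[OF Phi_circ_ex1[OF assms]] unfolding Phi_circ_def encoded_by_iff by blast+

lemma inj_on_Phi_circ: "inj_on (Phi_circ \<beta>) (lower_ideals \<beta>)"
proof (rule inj_onI)
  fix I J assume I: "I \<in> lower_ideals \<beta>" and J: "J \<in> lower_ideals \<beta>" and "Phi_circ \<beta> I = Phi_circ \<beta> J"
  then have "code_eq \<beta> (PHC \<beta> (encode \<beta> I)) (PHC \<beta> (encode \<beta> J))"
    using Phi_circ(2)[OF I] Phi_circ(2)[OF J] by (simp add: code_eq_def)
  then have "code_eq \<beta> (encode \<beta> I) (encode \<beta> J)"
    by (rule PHC_inj[OF comp lower_code_encode[OF I] lower_code_encode[OF J]])
  then show "I = J" by (rule lower_ideal_unique[OF I J])
qed

lemma bij_betw_Phi_circ: "bij_betw (Phi_circ \<beta>) (lower_ideals \<beta>) (upper_ideals \<beta>)"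
proof -
  have "Phi_circ \<beta> ` lower_ideals \<beta> = upper_ideals \<beta>"
    using Phi_circ(1) card_image[OF inj_on_Phi_circ] card_lower_ideals
    by (intro card_subset_eq[OF finite_upper_ideals]) auto
  then show ?thesis using inj_on_Phi_circ by (simp add: bij_betw_def)
qed

lemma card_Phi_circ:
  assumes I: "I \<in> lower_ideals \<beta>"
  shows "card (Phi_circ \<beta> I) = card I"
proof -
  have "card (Phi_circ \<beta> I) = code_size \<beta> (encode \<beta> (Phi_circ \<beta> I))"
    using Phi_circ(1)[OF I] by (simp add: code_size_encode upper_ideals_def)
  also have "\<dots> = code_size \<beta> (PHC \<beta> (encode \<beta> I))"
    using Phi_circ(2)[OF I] by (simp add: code_size_def code_eq_def)
  also have "\<dots> = code_size \<beta> (encode \<beta> I)"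
    by (rule code_size_PHC[OF comp lower_code_encode[OF I]])
  also have "\<dots> = card I"
    using I by (simp add: code_size_encode lower_ideals_def)
  finally show ?thesis .
qed

end

text \<open>\<open>Phi_circ\<close> is a definite description; the first conjunct ensures that it
  denotes the filter with the code computed by (PHC1) to (PHC3).\<close>

theorem theorem3p2:
  fixes \<beta> :: "nat list" and l :: nat
  assumes "composition \<beta>" and "length \<beta> = 2 * l" and "1 \<le> l"
  shows "(\<forall>I \<in> lower_ideals \<beta>. \<exists>!U. U \<in> upper_ideals \<beta> \<and> encoded_by \<beta> U (PHC \<beta> (encode \<beta> I)))
    \<and> bij_betw (Phi_circ \<beta>) (lower_ideals \<beta>) (upper_ideals \<beta>)
    \<and> (\<forall>I \<in> lower_ideals \<beta>. card (Phi_circ \<beta> I) = card I)"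
  using Phi_circ_ex1[OF assms] bij_betw_Phi_circ[OF assms] card_Phi_circ[OF assms] by blast

end
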